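(* Let $C$ be a closed normal cone with nonempty interior $C^\circ$ in a real Banach space $X$. Let $f\colon C^\circ\to C^\circ$ be an order-preserving homogeneous mapping with no eigenvector in $C^\circ$, and suppose that $f$ has converging approximate eigenvectors. Then there exists a net $(v_\alpha)$ in $C^\circ$ with $v_\alpha\to v\in\partial C$ in norm and $|v|=1$, such that $i_F(v_\alpha)\to h_F\in\mathcal{H}_F$, $i_R(v_\alpha)\to h_R\in\mathcal{H}_R$ and $i_H(v_\alpha)\to h_H\in\mathcal{H}_H$, with $h_H(x)=h_F(x)+h_R(x)$ for all $x\in C^\circ$, and such that for all $x\in C^\circ$: 1. $h_F(f(x))\le h_F(x)+\log r_{C^\circ}(f)$, 2. $h_R(f(x))\le h_R(x)-\log r_{C^\circ}(f)$, 3. $h_H(f(x))\le h_H(x)$. Moreover, there exists $y\in\partial C\setminus\{0\}$ such that $h_R(x)=\mathrm{RFunk}_C(x,y)$ for all $x\in C^\circ$.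
   Context: A cone $C\subseteq X$ is a convex set with $C\cap(-C)=\{0\}$ and $\lambda C\subseteq C$ for all $\lambda\ge0$; $x\le_C y$ means $y-x\in C$. $C$ is normal if there is $\kappa\ge0$ with $\|x\|\le\kappa\|y\|$ whenever $0\le_C x\le_C y$. $f$ is order-preserving if $x\le_C y$ implies $f(x)\le_C f(y)$, and homogeneous if $f(\lambda x)=\lambda f(x)$ for $\lambda>0$. The partial spectral radius is $r_{C^\circ}(f)=\lim_{k\to\infty}\|f^k\|_{C^\circ}^{1/k}$ with $\|f^k\|_{C^\circ}=\sup\{\|f^k(x)\|\colon x\in C^\circ,\|x\|\le1\}$; it is positive. Approximate eigenvectors: fix a norm $|\cdot|$ on $X$ equivalent to $\|\cdot\|$ which is monotone ($|x|\le|y|$ whenever $0\le_C x\le_C y$); such a norm exists as $C$ is normal. Fix $u\in C^\circ$ with $\|u\|=1$. For $\epsilon>0$ the map $f_{\epsilon,u}(x)=f(x)+\epsilon|x|u$ on $C^\circ$ has a unique eigenvector $v_{\epsilon,u}\in C^\circ$ with $|v_{\epsilon,u}|=1$. We say that $f$ has converging approximate eigenvectors if there is a sequence $\epsilon_n\to0^+$ such that $(v_{\epsilon_n,u})_n$ converges in the norm topology. Horofunctions: for $x\in X$, $y\in C^\circ$, $M(x/y)=\inf\{\beta\in\mathbb{R}\colon x\le_C\beta y\}$. For $x,y\in C^\circ$ put $\mathrm{Funk}_C(x,y)=\log M(x/y)$, $\mathrm{RFunk}_C(x,y)=\log M(y/x)$, $\delta_C(x,y)=\mathrm{Funk}_C(x,y)+\mathrm{RFunk}_C(x,y)$,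 and $d_C(x,y)=\log\max\{M(x/y),M(y/x)\}$; $\mathrm{RFunk}_C(x,y)=\log M(y/x)$ also for $x\in C^\circ$, $y\in C\setminus\{0\}$. $\mathcal{C}(C^\circ)$ is the space of continuous functions $(C^\circ,d_C)\to\mathbb{R}$ with the topology of uniform convergence on compact sets. Fix a base point $b\in C^\circ$. For $\rho\in\{\mathrm{Funk}_C,\mathrm{RFunk}_C,\delta_C\}$ let $i_\rho(y)(x)=\rho(x,y)-\rho(b,y)$; write $i_F,i_R,i_H$ for $i_\rho$ in the three cases, and $\mathcal{H}_F,\mathcal{H}_R,\mathcal{H}_H$ for the corresponding horofunction boundaries $\overline{i_\rho(C^\circ)}\setminus i_\rho(C^\circ)$ (closure in $\mathcal{C}(C^\circ)$). The convergences $i_\rho(v_\alpha)\to h$ are in $\mathcal{C}(C^\circ)$. *)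

theory Defs
  imports "HOL-Analysis.Analysis"
begin

section \<open>Cones and the induced order\<close>

definition pointed_cone :: "'a::real_vector set \<Rightarrow> bool" where
  "pointed_cone C \<longleftrightarrow> convex C \<and> cone C \<and> C \<inter> uminus ` C = {0}"

definition cone_le :: "'a::real_vector set \<Rightarrow> 'a \<Rightarrow> 'a \<Rightarrow> bool" where
  "cone_le C x y \<longleftrightarrow> y - x \<in> C"

definition normal_cone :: "'a::real_normed_vector set \<Rightarrow> bool" where
  "normal_cone C \<longleftrightarrow>
     (\<exists>\<kappa>\<ge>0. \<forall>x y. cone_le C 0 x \<and> cone_le C x y \<longrightarrow> norm x \<le> \<kappa> * norm y)"

definition order_preserving_on :: "'a::real_vector set \<Rightarrow> 'a set \<Rightarrow> ('a \<Rightarrow> 'a) \<Rightarrow> bool" where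
  "order_preserving_on C S f \<longleftrightarrow>
     (\<forall>x\<in>S. \<forall>y\<in>S. cone_le C x y \<longrightarrow> cone_le C (f x) (f y))"

definition homogeneous_on :: "'a::real_vector set \<Rightarrow> ('a \<Rightarrow> 'a) \<Rightarrow> bool" where
  "homogeneous_on S f \<longleftrightarrow> (\<forall>x\<in>S. \<forall>c>0. f (c *\<^sub>R x) = c *\<^sub>R f x)"

definition is_eigenvector :: "('a::real_vector \<Rightarrow> 'a) \<Rightarrow> 'a \<Rightarrow> bool" where
  "is_eigenvector g x \<longleftrightarrow> x \<noteq> 0 \<and> (\<exists>c. g x = c *\<^sub>R x)"


section \<open>The partial spectral radius\<close>

definition partial_norm :: "'a::real_normed_vector set \<Rightarrow> ('a \<Rightarrow> 'a) \<Rightarrow> real" where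
  "partial_norm C g = (SUP x\<in>{x \<in> interior C. norm x \<le> 1}. norm (g x))"

definition partial_spectral_radius :: "'a::real_normed_vector set \<Rightarrow> ('a \<Rightarrow> 'a) \<Rightarrow> real" where
  "partial_spectral_radius C f = lim (\<lambda>k. root k (partial_norm C (f ^^ k)))"


section \<open>Approximate eigenvectors\<close>

definition equivalent_norm :: "('a::real_normed_vector \<Rightarrow> real) \<Rightarrow> bool" where
  "equivalent_norm N \<longleftrightarrow>
     (\<forall>x. N x = 0 \<longleftrightarrow> x = 0) \<and>
     (\<forall>c x. N (c *\<^sub>R x) = \<bar>c\<bar> * N x) \<and>
     (\<forall>x y. N (x + y) \<le> N x + N y) \<and>
     (\<exists>a>0. \<exists>b>0. \<forall>x. a * norm x \<le> N x \<and> N x \<le> b * norm x)"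

definition monotone_norm :: "'a::real_vector set \<Rightarrow> ('a \<Rightarrow> real) \<Rightarrow> bool" where
  "monotone_norm C N \<longleftrightarrow> (\<forall>x y. cone_le C 0 x \<and> cone_le C x y \<longrightarrow> N x \<le> N y)"

definition perturbed_map ::
    "('a::real_vector \<Rightarrow> real) \<Rightarrow> 'a \<Rightarrow> ('a \<Rightarrow> 'a) \<Rightarrow> real \<Rightarrow> 'a \<Rightarrow> 'a" where
  "perturbed_map N u f \<epsilon> x = f x + (\<epsilon> * N x) *\<^sub>R u"

text \<open>The normalised eigenvector of the perturbed map in the interior of the cone is unique,
  so for \<open>\<epsilon> > 0\<close> this relation holds of exactly one vector, usually written as a function of
  \<open>\<epsilon>\<close> and \<open>u\<close>.\<close>

definition is_approx_eigenvector ::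
    "'a::real_normed_vector set \<Rightarrow> ('a \<Rightarrow> real) \<Rightarrow> 'a \<Rightarrow> ('a \<Rightarrow> 'a) \<Rightarrow> real \<Rightarrow> 'a \<Rightarrow> bool" where
  "is_approx_eigenvector C N u f \<epsilon> v \<longleftrightarrow>
     v \<in> interior C \<and> N v = 1 \<and> is_eigenvector (perturbed_map N u f \<epsilon>) v"

definition converging_approx_eigenvectors ::
    "'a::real_normed_vector set \<Rightarrow> ('a \<Rightarrow> real) \<Rightarrow> 'a \<Rightarrow> ('a \<Rightarrow> 'a) \<Rightarrow> bool" where
  "converging_approx_eigenvectors C N u f \<longleftrightarrow>
     (\<exists>\<epsilon> w. (\<forall>n::nat. 0 < \<epsilon> n) \<and> \<epsilon> \<longlonglongrightarrow> 0 \<and>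
            (\<forall>n. is_approx_eigenvector C N u f (\<epsilon> n) (w n)) \<and> convergent w)"


section \<open>Funk, reverse Funk, Hilbert and Thompson metrics\<close>

definition cone_M :: "'a::real_vector set \<Rightarrow> 'a \<Rightarrow> 'a \<Rightarrow> real" where
  "cone_M C x y = Inf {\<beta>. cone_le C x (\<beta> *\<^sub>R y)}"

definition Funk :: "'a::real_vector set \<Rightarrow> 'a \<Rightarrow> 'a \<Rightarrow> real" where
  "Funk C x y = ln (cone_M C x y)"

definition RFunk :: "'a::real_vector set \<Rightarrow> 'a \<Rightarrow> 'a \<Rightarrow> real" where
  "RFunk C x y = ln (cone_M C y x)"

definition Hilbert :: "'a::real_vector set \<Rightarrow> 'a \<Rightarrow> 'a \<Rightarrow> real" where
  "Hilbert C x y = Funk C x y + RFunk C x y"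

text \<open>The locale \<^locale>\<open>Metric_space\<close> requires nonnegativity also outside the carrier,
  whence the default value \<open>0\<close> there.\<close>

definition Thompson :: "'a::real_normed_vector set \<Rightarrow> 'a \<Rightarrow> 'a \<Rightarrow> real" where
  "Thompson C x y =
     (if x \<in> interior C \<and> y \<in> interior C then ln (max (cone_M C x y) (cone_M C y x)) else 0)"

lemma pointed_coneD:
  assumes "pointed_cone C"
  shows pointed_cone_add: "x \<in> C \<Longrightarrow> y \<in> C \<Longrightarrow> x + y \<in> C"
    and pointed_cone_scale: "x \<in> C \<Longrightarrow> 0 \<le> c \<Longrightarrow> c *\<^sub>R x \<in> C"
    and pointed_cone_eq_0: "x \<in> C \<Longrightarrow> - x \<in> C \<Longrightarrow> x = 0"
proof -
  have c: "convex C" "cone C" "C \<inter> uminus ` C = {0}"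
    using assms by (auto simp: pointed_cone_def)
  show "x \<in> C \<Longrightarrow> y \<in> C \<Longrightarrow> x + y \<in> C"
    using c convex_cone by blast
  show "x \<in> C \<Longrightarrow> 0 \<le> c \<Longrightarrow> c *\<^sub>R x \<in> C"
    using c(2) by (auto simp: cone_def)
  show "x \<in> C \<Longrightarrow> - x \<in> C \<Longrightarrow> x = 0"
    using c(3) by (metis IntI image_eqI minus_minus singletonD)
qed

lemma cone_le_refl: "pointed_cone C \<Longrightarrow> cone_le C x x"
  by (auto simp: pointed_cone_def cone_le_def)

lemma cone_le_trans: "pointed_cone C \<Longrightarrow> cone_le C x y \<Longrightarrow> cone_le C y z \<Longrightarrow> cone_le C x z"
  using pointed_cone_add[of C "y - x" "z - y"] by (simp add: cone_le_def)

lemma cone_le_antisym: "pointed_cone C \<Longrightarrow> cone_le C x y \<Longrightarrow> cone_le C y x \<Longrightarrow> x = y"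
  using pointed_cone_eq_0[of C "y - x"] by (simp add: cone_le_def)

lemma cone_le_scale:
  "pointed_cone C \<Longrightarrow> cone_le C x y \<Longrightarrow> 0 \<le> c \<Longrightarrow> cone_le C (c *\<^sub>R x) (c *\<^sub>R y)"
  using pointed_cone_scale[of C "y - x" c] by (simp add: cone_le_def scaleR_diff_right)

lemma cone_le_ex_multiple:
  fixes C :: "'a::real_normed_vector set"
  assumes "pointed_cone C" "y \<in> interior C"
  shows "\<exists>\<beta>. cone_le C x (\<beta> *\<^sub>R y)"
proof -
  obtain e where e: "e > 0" "ball y e \<subseteq> C"
    using assms(2) mem_interior by blast
  define t where "t = e / (2 * (norm x + 1))"
  have n: "norm x + 1 > 0"
    using norm_ge_zero[of x] by linarith
  have t: "t > 0" "t * norm x < e"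
  proof -
    show "t > 0"
      using e n by (simp add: t_def)
    have "t * norm x < t * (2 * (norm x + 1))"
      using \<open>t > 0\<close> n norm_ge_zero[of x] by (smt (verit) mult_strict_left_mono)
    also have "\<dots> = e"
      using n by (simp add: t_def)
    finally show "t * norm x < e" .
  qed
  then have "y - t *\<^sub>R x \<in> C"
    using e by (intro subsetD[OF e(2)]) (simp add: dist_norm)
  then have "(1 / t) *\<^sub>R (y - t *\<^sub>R x) \<in> C"
    using assms(1) t pointed_cone_scale by (metis less_imp_le zero_less_divide_1_iff)
  then have "cone_le C x ((1 / t) *\<^sub>R y)"
    using t by (simp add: cone_le_def scaleR_diff_right)
  then show ?thesis ..
qed

lemma cone_M_bdd_below:
  fixes C :: "'a::real_normed_vector set"
  assumes "pointed_cone C" "closed C" "y \<in> C" "y \<noteq> 0"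
  shows "bdd_below {\<beta>. cone_le C x (\<beta> *\<^sub>R y)}"
proof (rule ccontr)
  assume nb: "\<not> ?thesis"
  have in_C: "- y - (1 / real (Suc n)) *\<^sub>R x \<in> C" for n
  proof -
    obtain \<beta> where b: "cone_le C x (\<beta> *\<^sub>R y)" "\<beta> < - real (Suc n)"
      using nb unfolding bdd_below_def
      by (metis linorder_not_less mem_Collect_eq)
    have "(\<beta> *\<^sub>R y - x) + (- real (Suc n) - \<beta>) *\<^sub>R y \<in> C"
      using b assms pointed_cone_add pointed_cone_scale unfolding cone_le_def
      by (metis diff_ge_0_iff_ge less_imp_le)
    moreover have "(\<beta> *\<^sub>R y - x) + (- real (Suc n) - \<beta>) *\<^sub>R y = - (real (Suc n) *\<^sub>R y) - x"
      by (simp only: scaleR_diff_left scaleR_minus_left) simp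
    ultimately have "- (real (Suc n) *\<^sub>R y) - x \<in> C"
      by (simp only:)
    then have "(1 / real (Suc n)) *\<^sub>R (- (real (Suc n) *\<^sub>R y) - x) \<in> C"
      by (intro pointed_cone_scale[OF assms(1)]) auto
    then show ?thesis
      by (simp add: scaleR_diff_right)
  qed
  have "(\<lambda>n. - y - (1 / real (Suc n)) *\<^sub>R x) \<longlonglongrightarrow> - y - 0 *\<^sub>R x"
    by (intro tendsto_intros LIMSEQ_Suc[OF lim_1_over_n])
  then have "- y \<in> C"
    using closed_sequentially[OF assms(2)] in_C by fastforce
  then show False
    using assms pointed_cone_eq_0 by blast
qed

lemma cone_le_cone_M:
  fixes C :: "'a::real_normed_vector set"
  assumes "pointed_cone C" "closed C" "y \<in> interior C" "y \<noteq> 0"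
  shows "cone_le C x (cone_M C x y *\<^sub>R y)"
proof -
  let ?S = "{\<beta>. cone_le C x (\<beta> *\<^sub>R y)}"
  have "?S = (\<lambda>\<beta>. \<beta> *\<^sub>R y - x) -` C"
    by (auto simp: cone_le_def)
  then have "closed ?S"
    using assms(2) by (auto intro!: continuous_closed_vimage continuous_intros)
  moreover have "?S \<noteq> {}"
    using cone_le_ex_multiple[OF assms(1,3)] by auto
  moreover have "bdd_below ?S"
    using assms interior_subset[of C] by (intro cone_M_bdd_below) auto
  ultimately have "Inf ?S \<in> ?S"
    by (intro closed_contains_Inf)
  then show ?thesis
    by (simp add: cone_M_def)
qed

lemma cone_M_le:
  fixes C :: "'a::real_normed_vector set"
  assumes "pointed_cone C" "closed C" "y \<in> C" "y \<noteq> 0" "cone_le C x (\<beta> *\<^sub>R y)"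
  shows "cone_M C x y \<le> \<beta>"
  unfolding cone_M_def using assms cone_M_bdd_below by (intro cInf_lower) auto

lemma Metric_space_Thompson:
  fixes C :: "'a::real_normed_vector set"
  assumes C: "pointed_cone C" "closed C" and ne: "0 \<notin> interior C"
  shows "Metric_space (interior C) (Thompson C)"
proof -
  let ?M = "cone_M C"
  have inC: "x \<in> C" "x \<noteq> 0" if "x \<in> interior C" for x
    using that ne interior_subset by auto
  have le: "cone_le C x (?M x y *\<^sub>R y)" if "y \<in> interior C" for x y
    using cone_le_cone_M[OF C] inC that by blast
  have lower: "?M x y \<le> \<beta>" if "y \<in> interior C" "cone_le C x (\<beta> *\<^sub>R y)" for x y \<beta>
    using cone_M_le[OF C] inC that by blast
  have pos: "?M x y > 0" if xy: "x \<in> interior C" "y \<in> interior C" for x y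
  proof (rule ccontr)
    assume "\<not> ?M x y > 0"
    then have "(?M x y *\<^sub>R y - x) + (- ?M x y) *\<^sub>R y \<in> C"
      using le[OF xy(2), of x] inC[OF xy(2)] unfolding cone_le_def
      by (intro pointed_cone_add[OF C(1)] pointed_cone_scale[OF C(1)]) auto
    then have "- x \<in> C" by simp
    then show False
      using pointed_cone_eq_0[OF C(1)] inC[OF xy(1)] by blast
  qed
  have sub: "?M x z \<le> ?M x y * ?M y z"
    if xyz: "x \<in> interior C" "y \<in> interior C" "z \<in> interior C" for x y z
  proof -
    have "cone_le C (?M x y *\<^sub>R y) (?M x y *\<^sub>R ?M y z *\<^sub>R z)"
      using le[OF xyz(3)] pos[OF xyz(1,2)] by (intro cone_le_scale[OF C(1)]) auto
    then have "cone_le C x (?M x y *\<^sub>R ?M y z *\<^sub>R z)"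
      using cone_le_trans[OF C(1)] le[OF xyz(2)] by blast
    then show ?thesis
      using lower xyz by simp
  qed
  have self: "?M x x = 1" if x: "x \<in> interior C" for x
  proof (rule antisym)
    show "?M x x \<le> 1"
      using lower[OF x] cone_le_refl[OF C(1)] by simp
    show "1 \<le> ?M x x"
      using sub[OF x x x] pos[OF x x] by simp
  qed
  have ge1: "max (?M x y) (?M y x) \<ge> 1" if xy: "x \<in> interior C" "y \<in> interior C" for x y
  proof (rule ccontr)
    assume "\<not> ?thesis"
    then have "?M x y * ?M y x < 1 * 1"
      using pos[OF xy] pos[OF xy(2,1)] by (intro mult_strict_mono) auto
    then show False
      using sub[OF xy(1,2,1)] self[OF xy(1)] by simp
  qed
  show ?thesis
  proof
    fix x y
    show "0 \<le> Thompson C x y"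
      using ge1 by (simp add: Thompson_def)
    show "Thompson C x y = Thompson C y x"
      by (auto simp: Thompson_def max.commute)
  next
    fix x y assume xy: "x \<in> interior C" "y \<in> interior C"
    show "Thompson C x y = 0 \<longleftrightarrow> x = y"
    proof
      assume "Thompson C x y = 0"
      then have m: "max (?M x y) (?M y x) = 1"
        using ge1[OF xy] xy by (simp add: Thompson_def)
      have *: "cone_le C a b" if ab: "a \<in> interior C" "b \<in> interior C" "?M a b \<le> 1" for a b
      proof -
        have "(?M a b *\<^sub>R b - a) + (1 - ?M a b) *\<^sub>R b \<in> C"
          using le[OF ab(2), of a] inC[OF ab(2)] ab(3) unfolding cone_le_def
          by (intro pointed_cone_add[OF C(1)] pointed_cone_scale[OF C(1)]) auto
        then show ?thesis
          by (simp add: cone_le_def algebra_simps)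
      qed
      have "?M x y \<le> 1" "?M y x \<le> 1"
        using m by linarith+
      then show "x = y"
        using * xy cone_le_antisym[OF C(1)] by blast
    next
      assume "x = y"
      then show "Thompson C x y = 0"
        using self xy by (simp add: Thompson_def)
    qed
  next
    fix x y z assume xyz: "x \<in> interior C" "y \<in> interior C" "z \<in> interior C"
    let ?p = "max (?M x y) (?M y x)" and ?q = "max (?M y z) (?M z y)"
    have pq: "?p \<ge> 1" "?q \<ge> 1"
      using ge1 xyz by auto
    have "?M x z \<le> ?p * ?q"
      using pos xyz pq by (intro order_trans[OF sub[OF xyz]] mult_mono) (auto intro: less_imp_le)
    moreover have "?M z x \<le> ?q * ?p"
      using pos xyz pq
      by (intro order_trans[OF sub[OF xyz(3,2,1)]] mult_mono) (auto intro: less_imp_le)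
    ultimately have "max (?M x z) (?M z x) \<le> ?p * ?q"
      by (simp add: mult.commute)
    then have "ln (max (?M x z) (?M z x)) \<le> ln (?p * ?q)"
      using ge1[OF xyz(1,3)] by (subst ln_le_cancel_iff) linarith+
    also have "\<dots> = ln ?p + ln ?q"
      using pq by (intro ln_mult_pos) linarith+
    finally show "Thompson C x z \<le> Thompson C x y + Thompson C y z"
      using xyz by (simp add: Thompson_def)
  qed
qed


section \<open>The topology of uniform convergence on compact sets\<close>

text \<open>A continuous function on the space \<open>T\<close> is represented by its unique extensional
  representative, so that equality of functions means equality on \<open>T\<close>.\<close>

definition cont_functions :: "'a topology \<Rightarrow> ('a \<Rightarrow> real) set" where
  "cont_functions T = {h \<in> extensional (topspace T). continuous_map T euclideanreal h}"

definition compact_conv_open :: "'a topology \<Rightarrow> ('a \<Rightarrow> real) set \<Rightarrow> bool" where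
  "compact_conv_open T U \<longleftrightarrow> U \<subseteq> cont_functions T \<and>
     (\<forall>h\<in>U. \<exists>K e. compactin T K \<and> 0 < e \<and>
        {g \<in> cont_functions T. \<forall>x\<in>K. \<bar>g x - h x\<bar> < e} \<subseteq> U)"

definition compact_conv_topology :: "'a topology \<Rightarrow> ('a \<Rightarrow> real) topology" where
  "compact_conv_topology T = topology (compact_conv_open T)"

lemma istopology_compact_conv_open: "istopology (compact_conv_open T)"
  unfolding istopology_def
proof (intro conjI allI impI)
  fix U V
  assume U: "compact_conv_open T U" and V: "compact_conv_open T V"
  show "compact_conv_open T (U \<inter> V)"
    unfolding compact_conv_open_def
  proof (intro conjI ballI)
    show "U \<inter> V \<subseteq> cont_functions T"
      using U by (auto simp: compact_conv_open_def)
    fix h assume h: "h \<in> U \<inter> V"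
    obtain K e where K: "compactin T K" "0 < e"
        "{g \<in> cont_functions T. \<forall>x\<in>K. \<bar>g x - h x\<bar> < e} \<subseteq> U"
      using U h unfolding compact_conv_open_def by blast
    obtain L d where L: "compactin T L" "0 < d"
        "{g \<in> cont_functions T. \<forall>x\<in>L. \<bar>g x - h x\<bar> < d} \<subseteq> V"
      using V h unfolding compact_conv_open_def by blast
    have "{g \<in> cont_functions T. \<forall>x\<in>K \<union> L. \<bar>g x - h x\<bar> < min e d} \<subseteq> U \<inter> V"
      using K(3) L(3) by auto
    moreover have "compactin T (K \<union> L)" "0 < min e d"
      using K(1,2) L(1,2) by (auto intro: compactin_Un)
    ultimately show "\<exists>K e. compactin T K \<and> 0 < e \<and>
        {g \<in> cont_functions T. \<forall>x\<in>K. \<bar>g x - h x\<bar> < e} \<subseteq> U \<inter> V"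
      by blast
  qed
next
  fix \<K>
  assume \<K>: "\<forall>U\<in>\<K>. compact_conv_open T U"
  show "compact_conv_open T (\<Union>\<K>)"
    unfolding compact_conv_open_def
  proof (intro conjI ballI)
    show "\<Union>\<K> \<subseteq> cont_functions T"
      using \<K> by (auto simp: compact_conv_open_def)
    fix h assume "h \<in> \<Union>\<K>"
    then obtain U where U: "U \<in> \<K>" "h \<in> U"
      by blast
    then obtain K e where "compactin T K" "0 < e"
        "{g \<in> cont_functions T. \<forall>x\<in>K. \<bar>g x - h x\<bar> < e} \<subseteq> U"
      using \<K> unfolding compact_conv_open_def by blast
    moreover have "U \<subseteq> \<Union>\<K>"
      using U(1) by blast
    ultimately show "\<exists>K e. compactin T K \<and> 0 < e \<and>
        {g \<in> cont_functions T. \<forall>x\<in>K. \<bar>g x - h x\<bar> < e} \<subseteq> \<Union>\<K>"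
      by (meson order_trans)
  qed
qed

lemma openin_compact_conv_topology:
  "openin (compact_conv_topology T) U \<longleftrightarrow> compact_conv_open T U"
  by (simp add: compact_conv_topology_def istopology_compact_conv_open)

lemma topspace_compact_conv_topology: "topspace (compact_conv_topology T) = cont_functions T"
proof (rule antisym)
  have "compact_conv_open T (cont_functions T)"
    unfolding compact_conv_open_def by (auto intro!: exI[of _ "{}"] exI[of _ 1])
  then show "cont_functions T \<subseteq> topspace (compact_conv_topology T)"
    by (metis openin_compact_conv_topology openin_subset)
  show "topspace (compact_conv_topology T) \<subseteq> cont_functions T"
    by (metis compact_conv_open_def openin_compact_conv_topology openin_topspace)
qed


section \<open>Horofunctions\<close>

definition horo_space :: "'a::real_normed_vector set \<Rightarrow> ('a \<Rightarrow> real) topology" where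
  "horo_space C = compact_conv_topology (Metric_space.mtopology (interior C) (Thompson C))"

definition horo_embed ::
    "'a::real_normed_vector set \<Rightarrow> 'a \<Rightarrow> ('a \<Rightarrow> 'a \<Rightarrow> real) \<Rightarrow> 'a \<Rightarrow> 'a \<Rightarrow> real" where
  "horo_embed C b \<rho> y = (\<lambda>x\<in>interior C. \<rho> x y - \<rho> b y)"

definition horo_boundary ::
    "'a::real_normed_vector set \<Rightarrow> 'a \<Rightarrow> ('a \<Rightarrow> 'a \<Rightarrow> real) \<Rightarrow> ('a \<Rightarrow> real) set" where
  "horo_boundary C b \<rho> =
     (horo_space C closure_of (horo_embed C b \<rho> ` interior C)) - horo_embed C b \<rho> ` interior C"


section \<open>Nets\<close>

definition directed_preorder :: "'i set \<Rightarrow> ('i \<Rightarrow> 'i \<Rightarrow> bool) \<Rightarrow> bool" where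
  "directed_preorder I le \<longleftrightarrow> I \<noteq> {} \<and> reflp_on I le \<and> transp_on I le \<and>
     (\<forall>i\<in>I. \<forall>j\<in>I. \<exists>k\<in>I. le i k \<and> le j k)"

definition net_filter :: "'i set \<Rightarrow> ('i \<Rightarrow> 'i \<Rightarrow> bool) \<Rightarrow> 'i filter" where
  "net_filter I le = (INF i\<in>I. principal {j \<in> I. le i j})"

lemma eventually_net_filter:
  assumes "directed_preorder I le"
  shows "eventually P (net_filter I le) \<longleftrightarrow> (\<exists>i\<in>I. \<forall>j\<in>I. le i j \<longrightarrow> P j)"
proof -
  have "eventually P (net_filter I le) \<longleftrightarrow> (\<exists>i\<in>I. eventually P (principal {j \<in> I. le i j}))"
    unfolding net_filter_def
  proof (rule eventually_INF_base)
    show "I \<noteq> {}"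
      using assms by (simp add: directed_preorder_def)
    fix i j assume ij: "i \<in> I" "j \<in> I"
    then obtain k where k: "k \<in> I" "le i k" "le j k"
      using assms unfolding directed_preorder_def by blast
    have "transp_on I le"
      using assms by (simp add: directed_preorder_def)
    then have "{l \<in> I. le k l} \<subseteq> {l \<in> I. le i l} \<inter> {l \<in> I. le j l}"
      using ij k by (auto dest: transp_onD)
    then show "\<exists>k\<in>I. principal {l \<in> I. le k l}
        \<le> inf (principal {l \<in> I. le i l}) (principal {l \<in> I. le j l})"
      using k(1) by (auto simp: inf_principal)
  qed
  then show ?thesis
    by (auto simp: eventually_principal)
qed

end

theory Submission
  imports Defs
begin

text \<open>
  Let \<open>v n\<close> be the approximate eigenvectors, with eigenvalues \<open>l n\<close> and limit \<open>w\<close>, and write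
  \<open>M\<close> for the gauge \<open>M(x/y)\<close>. The equation \<open>f (v n) + \<epsilon> n u = l n v n\<close> gives two estimates for
  interior \<open>x\<close>: \<open>M (f x) (v n) \<le> l n M x (v n)\<close>, because \<open>f (v n)\<close> is dominated by
  \<open>l n v n\<close>; and \<open>l n M (v n) (f x) \<le> M (v n) x (1 + O(\<epsilon> n))\<close>, because \<open>u\<close> is dominated by a
  multiple of \<open>f x\<close> while \<open>N (v n) = 1\<close> keeps \<open>M (v n) x\<close> away from 0. Iterated along the orbit
  of \<open>u\<close>, they show that the partial spectral radius \<open>r\<close> exists as a limit, is positive, and is
  the limit of the \<open>l n\<close> (\<open>eigenvalues_tendsto_radius\<close>). If \<open>w\<close> were interior, it would be an
  eigenvector of \<open>f\<close>, so \<open>w\<close> lies in the boundary (\<open>limit_in_frontier\<close>).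

  The functions \<open>i\<^sub>F (v n)\<close> are 1-Lipschitz for Thompson's metric and pointwise bounded. By
  Tychonoff's theorem they converge pointwise along a filter finer than the sequential one, and
  equi-Lipschitz functions that converge pointwise converge uniformly on compact sets. The reverse
  Funk functions converge along the whole sequence, because \<open>M (v n) x\<close> tends to \<open>M w x\<close>; this also
  identifies their limit as \<open>RFunk C x y\<close> with \<open>y\<close> a multiple of \<open>w\<close>. Hilbert's metric
  is the sum of the two. The filter is turned into a net by \<open>net_for_filter\<close>. The three
  inequalities are the limits of the logarithms of the two estimates, and their sum.

  The limits are not of the form \<open>i\<^sub>\<rho> z\<close> with \<open>z\<close> interior. For the Funk and Hilbert metrics this holds
  since the limits tend to minus infinity at \<open>w + \<delta> b\<close> as \<open>\<delta>\<close> tends to 0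
  (\<open>Funk_horofunction_near_boundary_point\<close>), while the distances to \<open>z\<close> are bounded below there. For
  the reverse Funk metric it holds since the limit determines the ray through \<open>w\<close>, which does not
  meet the interior.
\<close>

section \<open>Gauges of a closed pointed cone\<close>

text \<open>Excluding 0 from the interior rules out only the cone that is the whole (then trivial)
  space.\<close>

locale closed_pointed_cone =
  fixes C :: "'a::real_normed_vector set"
  assumes pointed: "pointed_cone C" and closed: "closed C" and zero_not_interior: "0 \<notin> interior C"
begin

abbreviation M :: "'a \<Rightarrow> 'a \<Rightarrow> real" where "M \<equiv> cone_M C"

abbreviation le :: "'a \<Rightarrow> 'a \<Rightarrow> bool" (infix "\<preceq>" 50) where "x \<preceq> y \<equiv> cone_le C x y"

lemmas le_refl = cone_le_refl[OF pointed]
  and le_trans = cone_le_trans[OF pointed]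
  and le_antisym = cone_le_antisym[OF pointed]
  and le_scale = cone_le_scale[OF pointed]

lemma interior_in_cone: "x \<in> interior C \<Longrightarrow> x \<in> C"
  and interior_nonzero: "x \<in> interior C \<Longrightarrow> x \<noteq> 0"
  using interior_subset zero_not_interior by auto

lemma le_add: "x \<preceq> y \<Longrightarrow> x' \<preceq> y' \<Longrightarrow> x + x' \<preceq> y + y'"
  using pointed_cone_add[OF pointed, of "y - x" "y' - x'"]
  by (simp add: cone_le_def algebra_simps)

lemma zero_le_iff: "0 \<preceq> x \<longleftrightarrow> x \<in> C"
  by (simp add: cone_le_def)

lemma scale_le_scale: "a \<le> c \<Longrightarrow> x \<in> C \<Longrightarrow> a *\<^sub>R x \<preceq> c *\<^sub>R x"
  using pointed_cone_scale[OF pointed, of x "c - a"] by (simp add: cone_le_def algebra_simps)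

lemma interior_upward:
  assumes "y \<in> interior C" "y \<preceq> x"
  shows "x \<in> interior C"
proof -
  have "(+) (x - y) ` C \<subseteq> C"
    using assms(2) pointed_cone_add[OF pointed] by (auto simp: cone_le_def)
  then have "interior ((+) (x - y) ` C) \<subseteq> interior C"
    by (rule interior_mono)
  moreover have "x \<in> (+) (x - y) ` interior C"
    using assms(1) by (force simp: image_iff)
  ultimately show ?thesis
    by (auto simp: interior_translation)
qed

lemma interior_scale:
  assumes "x \<in> interior C" "c > 0"
  shows "c *\<^sub>R x \<in> interior C"
proof -
  obtain e where e: "e > 0" "ball x e \<subseteq> C"
    using assms(1) mem_interior by blast
  have "ball (c *\<^sub>R x) (c * e) \<subseteq> C"
  proof
    fix y assume "y \<in> ball (c *\<^sub>R x) (c * e)"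
    then have "norm (c *\<^sub>R (x - (1 / c) *\<^sub>R y)) < c * e"
      using assms(2) by (simp add: dist_norm algebra_simps)
    then have "(1 / c) *\<^sub>R y \<in> C"
      using assms(2) by (intro subsetD[OF e(2)]) (simp add: dist_norm)
    then have "c *\<^sub>R ((1 / c) *\<^sub>R y) \<in> C"
      using assms(2) pointed_cone_scale[OF pointed] less_imp_le by blast
    moreover have "c *\<^sub>R ((1 / c) *\<^sub>R y) = y"
      using assms(2) by simp
    ultimately show "y \<in> C"
      by metis
  qed
  then show ?thesis
    using assms(2) e(1) by (intro interiorI[OF open_ball]) auto
qed

text \<open>Interior points are order units, with a bound that is linear in the norm. This is the link
  between norm convergence and the order.\<close>

lemma order_unit:
  assumes "y \<in> interior C"
  obtains K where "K > 0" "\<And>x. x \<preceq> (K * norm x) *\<^sub>R y"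
proof -
  obtain e where e: "e > 0" "ball y e \<subseteq> C"
    using assms mem_interior by blast
  have "x \<preceq> ((2 / e) * norm x) *\<^sub>R y" for x
  proof (cases "x = 0")
    case True
    then show ?thesis using le_refl by simp
  next
    case False
    define c where "c = 2 * norm x / e"
    have c: "c > 0" using False e by (simp add: c_def)
    have "norm ((1 / c) *\<^sub>R x) < e"
      using False e by (simp add: c_def)
    then have "y - (1 / c) *\<^sub>R x \<in> C"
      by (intro subsetD[OF e(2)]) (simp add: dist_norm)
    then have "c *\<^sub>R (y - (1 / c) *\<^sub>R x) \<in> C"
      using c by (intro pointed_cone_scale[OF pointed]) auto
    moreover have "c *\<^sub>R (y - (1 / c) *\<^sub>R x) = c *\<^sub>R y - x"
      using c by (simp add: scaleR_diff_right)
    ultimately show ?thesis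
      by (simp add: cone_le_def c_def)
  qed
  then show ?thesis
    using that[of "2 / e"] e by simp
qed

lemma le_M: "y \<in> interior C \<Longrightarrow> x \<preceq> M x y *\<^sub>R y"
  using cone_le_cone_M[OF pointed closed] interior_nonzero by blast

lemma M_le: "y \<in> interior C \<Longrightarrow> x \<preceq> c *\<^sub>R y \<Longrightarrow> M x y \<le> c"
  using cone_M_le[OF pointed closed] interior_in_cone interior_nonzero by blast

lemma M_pos:
  assumes "x \<in> C" "x \<noteq> 0" "y \<in> interior C"
  shows "M x y > 0"
proof (rule ccontr)
  assume "\<not> M x y > 0"
  then have "M x y *\<^sub>R y \<preceq> 0 *\<^sub>R y"
    using assms(3) interior_in_cone by (intro scale_le_scale) auto
  then have "x \<preceq> 0"
    using le_trans[OF le_M[OF assms(3)]] by simp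
  then show False
    using assms(1,2) le_antisym zero_le_iff by blast
qed

lemma M_pos_interior: "x \<in> interior C \<Longrightarrow> y \<in> interior C \<Longrightarrow> M x y > 0"
  using M_pos interior_in_cone interior_nonzero by blast

lemma M_trans:
  assumes "x \<in> C" "x \<noteq> 0" "y \<in> interior C" "z \<in> interior C"
  shows "M x z \<le> M x y * M y z"
proof (rule M_le[OF assms(4)])
  have "M x y *\<^sub>R y \<preceq> M x y *\<^sub>R M y z *\<^sub>R z"
    using le_M[OF assms(4)] M_pos[OF assms(1-3)] by (intro le_scale) auto
  then show "x \<preceq> (M x y * M y z) *\<^sub>R z"
    using le_trans[OF le_M[OF assms(3)]] by simp
qed

lemma M_self: "x \<in> interior C \<Longrightarrow> M x x = 1"
proof (rule antisym)
  assume x: "x \<in> interior C"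
  show "M x x \<le> 1"
    using M_le[OF x] le_refl by simp
  show "1 \<le> M x x"
    using M_trans[OF interior_in_cone[OF x] interior_nonzero[OF x] x x] M_pos_interior[OF x x]
    by simp
qed

lemma M_scale_left:
  assumes "y \<in> interior C" "c > 0"
  shows "M (c *\<^sub>R x) y = c * M x y"
proof (rule antisym)
  show "M (c *\<^sub>R x) y \<le> c * M x y"
    using le_scale[OF le_M[OF assms(1)], of c x] assms by (intro M_le) auto
  have "(1 / c) *\<^sub>R (c *\<^sub>R x) \<preceq> (1 / c) *\<^sub>R (M (c *\<^sub>R x) y *\<^sub>R y)"
    using assms by (intro le_scale le_M) auto
  then have "M x y \<le> 1 / c * M (c *\<^sub>R x) y"
    using assms by (intro M_le) auto
  then show "c * M x y \<le> M (c *\<^sub>R x) y"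
    using assms(2) by (simp add: field_simps)
qed

lemma M_mono_left: "x \<preceq> x' \<Longrightarrow> y \<in> interior C \<Longrightarrow> M x y \<le> M x' y"
  using M_le le_trans le_M by blast

lemma M_add_left:
  assumes "y \<in> interior C"
  shows "M (x + x') y \<le> M x y + M x' y"
  using le_add[OF le_M[OF assms] le_M[OF assms], of x x']
  by (intro M_le[OF assms]) (simp only: scaleR_add_left)

lemma M_tendsto_left:
  assumes "(g \<longlongrightarrow> x) G" "y \<in> interior C"
  shows "((\<lambda>i. M (g i) y) \<longlongrightarrow> M x y) G"
proof -
  obtain K where K: "K > 0" "\<And>z. z \<preceq> (K * norm z) *\<^sub>R y"
    using order_unit[OF assms(2)] by blast
  have bd: "M z y \<le> K * norm z" for z
    using M_le[OF assms(2) K(2)] .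
  have *: "\<bar>M z y - M x y\<bar> \<le> K * norm (z - x)" for z
    using M_add_left[OF assms(2), of x "z - x"] M_add_left[OF assms(2), of z "x - z"]
      bd[of "z - x"] bd[of "x - z"] by (auto simp: norm_minus_commute)
  have "((\<lambda>i. K * norm (g i - x)) \<longlongrightarrow> 0) G"
    using assms(1) by (intro tendsto_mult_right_zero tendsto_norm_zero) (simp add: LIM_zero)
  then have "((\<lambda>i. M (g i) y - M x y) \<longlongrightarrow> 0) G"
    by (rule Lim_null_comparison[rotated]) (use * in auto)
  then show ?thesis
    by (rule LIM_zero_cancel)
qed

lemma log_M_trans:
  assumes "x \<in> C" "x \<noteq> 0" "y \<in> interior C" "z \<in> interior C"
  shows "ln (M x z) \<le> ln (M x y) + ln (M y z)"
proof -
  have "ln (M x z) \<le> ln (M x y * M y z)"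
    using M_trans[OF assms] M_pos[OF assms(1,2,4)] by simp
  also have "\<dots> = ln (M x y) + ln (M y z)"
    using M_pos[OF assms(1-3)] M_pos_interior[OF assms(3,4)] by (intro ln_mult_pos)
  finally show ?thesis .
qed

lemma Thompson_ge:
  assumes "x \<in> interior C" "y \<in> interior C"
  shows "ln (M x y) \<le> Thompson C x y" "ln (M y x) \<le> Thompson C x y"
proof -
  have "M x y > 0" "M y x > 0"
    using M_pos_interior assms by blast+
  then show "ln (M x y) \<le> Thompson C x y" "ln (M y x) \<le> Thompson C x y"
    using assms by (simp_all add: Thompson_def max_def)
qed

text \<open>All (reverse) Funk functions are 1-Lipschitz for Thompson's metric; in the reverse case also
  those of boundary points.\<close>

lemma Funk_Lipschitz:
  assumes "x \<in> interior C" "x' \<in> interior C" "y \<in> interior C"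
  shows "\<bar>Funk C x y - Funk C x' y\<bar> \<le> Thompson C x x'"
proof -
  have "ln (M x y) \<le> ln (M x x') + ln (M x' y)" "ln (M x' y) \<le> ln (M x' x) + ln (M x y)"
    using assms by (auto intro!: log_M_trans interior_in_cone interior_nonzero)
  then show ?thesis
    using Thompson_ge[OF assms(1,2)] by (simp add: Funk_def abs_le_iff)
qed

lemma RFunk_Lipschitz:
  assumes "x \<in> interior C" "x' \<in> interior C" "y \<in> C" "y \<noteq> 0"
  shows "\<bar>RFunk C x y - RFunk C x' y\<bar> \<le> Thompson C x x'"
proof -
  have "ln (M y x) \<le> ln (M y x') + ln (M x' x)" "ln (M y x') \<le> ln (M y x) + ln (M x x')"
    using assms by (auto intro!: log_M_trans)
  then show ?thesis
    using Thompson_ge[OF assms(1,2)] by (simp add: RFunk_def abs_le_iff)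
qed

lemma Hilbert_nonneg:
  assumes "x \<in> interior C" "y \<in> interior C"
  shows "Hilbert C x y \<ge> 0"
  using log_M_trans[OF interior_in_cone[OF assms(1)] interior_nonzero[OF assms(1)] assms(2,1)]
    M_self[OF assms(1)] by (simp add: Hilbert_def Funk_def RFunk_def)

end

section \<open>Uniform convergence on compact sets\<close>

lemma (in Metric_space) Lipschitz_cont_functions:
  fixes h :: "'a \<Rightarrow> real"
  assumes "h \<in> extensional M" "\<And>x y. x \<in> M \<Longrightarrow> y \<in> M \<Longrightarrow> \<bar>h x - h y\<bar> \<le> L * d x y"
  shows "h \<in> cont_functions mtopology"
proof -
  have "\<exists>r>0. \<forall>x. x \<in> M \<and> d a x < r \<longrightarrow> h x \<in> U" if a: "a \<in> M" and U: "open U" "h a \<in> U" for a U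
  proof -
    obtain e where e: "e > 0" "ball (h a) e \<subseteq> U"
      using U openE by blast
    have "h x \<in> U" if x: "x \<in> M" "d a x < e / (\<bar>L\<bar> + 1)" for x
    proof -
      have "\<bar>h a - h x\<bar> \<le> L * d a x"
        using assms(2) a x by blast
      also have "\<dots> \<le> (\<bar>L\<bar> + 1) * d a x"
        by (intro mult_right_mono) auto
      also have "\<dots> < e"
        using x(2) by (simp add: field_simps)
      finally show ?thesis
        using e(2) by (auto simp: dist_real_def)
    qed
    moreover have "e / (\<bar>L\<bar> + 1) > 0"
      using e(1) by simp
    ultimately show ?thesis by blast
  qed
  then show ?thesis
    using assms(1) by (auto simp: cont_functions_def continuous_map_from_metric)
qed

text \<open>For equi-Lipschitz functions pointwise convergence is uniform on totally bounded sets.\<close>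

lemma (in Metric_space) Lipschitz_limitin_compact_conv:
  fixes g :: "'i \<Rightarrow> 'a \<Rightarrow> real"
  assumes G: "G \<noteq> bot"
    and g: "\<And>i. g i \<in> extensional M"
      "\<And>i x y. x \<in> M \<Longrightarrow> y \<in> M \<Longrightarrow> \<bar>g i x - g i y\<bar> \<le> L * d x y"
    and h: "h \<in> extensional M" "\<And>x. x \<in> M \<Longrightarrow> ((\<lambda>i. g i x) \<longlongrightarrow> h x) G"
  shows "limitin (compact_conv_topology mtopology) g h G"
proof -
  have h_Lip: "\<bar>h x - h y\<bar> \<le> L * d x y" if "x \<in> M" "y \<in> M" for x y
  proof (rule tendsto_upperbound[OF _ _ G])
    show "((\<lambda>i. \<bar>g i x - g i y\<bar>) \<longlongrightarrow> \<bar>h x - h y\<bar>) G"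
      using that by (intro tendsto_intros h)
  qed (use g(2) that in auto)
  have cont: "h \<in> cont_functions mtopology" "\<And>i. g i \<in> cont_functions mtopology"
    using Lipschitz_cont_functions[OF h(1) h_Lip] Lipschitz_cont_functions[OF g] by blast+
  have "\<forall>\<^sub>F i in G. g i \<in> U" if U: "compact_conv_open mtopology U" "h \<in> U" for U
  proof -
    obtain K e where K: "compactin mtopology K" "0 < e"
      "{k \<in> cont_functions mtopology. \<forall>x\<in>K. \<bar>k x - h x\<bar> < e} \<subseteq> U"
      using U unfolding compact_conv_open_def by blast
    define r where "r = e / 3 / (\<bar>L\<bar> + 1)"
    have L: "\<bar>L\<bar> + 1 > 0"
      by linarith
    have r: "r > 0"
      using K(2) L by (simp add: r_def)
    obtain S where S: "finite S" "S \<subseteq> K" "K \<subseteq> (\<Union>x\<in>S. mball x r)"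
      using compactin_imp_mtotally_bounded[OF K(1), unfolded mtotally_bounded_def, rule_format, OF r]
      by (elim exE conjE)
    have KM: "K \<subseteq> M"
      using compactin_subset_topspace[OF K(1)] by (simp only: topspace_mtopology)
    have "\<forall>\<^sub>F i in G. \<forall>s\<in>S. \<bar>g i s - h s\<bar> < e / 3"
    proof (intro eventually_ball_finite S(1) ballI)
      fix s assume "s \<in> S"
      then show "\<forall>\<^sub>F i in G. \<bar>g i s - h s\<bar> < e / 3"
        using tendstoD[OF h(2), of s "e / 3"] S KM K(2) by (auto simp: dist_real_def)
    qed
    then show ?thesis
    proof eventually_elim
      case (elim i)
      have "\<bar>g i x - h x\<bar> < e" if x: "x \<in> K" for x
      proof -
        obtain s where s: "s \<in> S" "d s x < r"
          using S(3) x by auto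
        have M: "s \<in> M" "x \<in> M"
          using s x S(2) KM by auto
        have "L * d s x \<le> (\<bar>L\<bar> + 1) * d s x"
          by (intro mult_right_mono) auto
        also have "\<dots> < (\<bar>L\<bar> + 1) * r"
          using s(2) by (intro mult_strict_left_mono) auto
        also have "\<dots> = e / 3"
          unfolding r_def using L
          by (metis less_irrefl nonzero_mult_div_cancel_left times_divide_eq_right)
        finally have "L * d s x < e / 3" .
        then show ?thesis
          using g(2)[OF M, of i] h_Lip[OF M] elim[rule_format, OF s(1)] by linarith
      qed
      then show ?case
        using K(3) cont(2) by auto
    qed
  qed
  then show ?thesis
    using cont(1)
    by (simp add: limitin_def topspace_compact_conv_topology openin_compact_conv_topology)
qed

section \<open>Nets and cluster points\<close>

text \<open>Every proper filter concentrated on \<open>S\<close> is the push-forward of the tail filter of a net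
  in \<open>S\<close>: the indices are the pointed sets of the filter, ordered by reverse inclusion.\<close>

lemma net_for_filter:
  fixes F :: "'a filter"
  assumes "F \<noteq> bot" "eventually (\<lambda>x. x \<in> S) F"
  obtains I :: "('a set \<times> 'a) set" and le
  where "directed_preorder I le" "\<And>\<alpha>. \<alpha> \<in> I \<Longrightarrow> snd \<alpha> \<in> S" "filtermap snd (net_filter I le) = F"
proof -
  define I where "I = {(A, x). x \<in> A \<and> A \<subseteq> S \<and> eventually (\<lambda>x. x \<in> A) F}"
  define le where "le = (\<lambda>(\<alpha> :: 'a set \<times> 'a) (\<beta> :: 'a set \<times> 'a). fst \<beta> \<subseteq> fst \<alpha>)"
  have ex: "\<exists>x. (A, x) \<in> I" if "A \<subseteq> S" "eventually (\<lambda>x. x \<in> A) F" for A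
    using eventually_happens'[OF assms(1) that(2)] that by (auto simp: I_def)
  have dir: "directed_preorder I le"
    unfolding directed_preorder_def
  proof (intro conjI ballI)
    show "I \<noteq> {}"
      using ex[of S] assms(2) by auto
    show "reflp_on I le" "transp_on I le"
      by (auto simp: le_def intro: reflp_onI transp_onI)
    fix i j assume "i \<in> I" "j \<in> I"
    then have "fst i \<inter> fst j \<subseteq> S" "eventually (\<lambda>x. x \<in> fst i \<inter> fst j) F"
      by (auto simp: I_def intro: eventually_conj)
    then obtain x where "(fst i \<inter> fst j, x) \<in> I"
      using ex by blast
    then show "\<exists>k\<in>I. le i k \<and> le j k"
      by (rule bexI[rotated]) (auto simp: le_def)
  qed
  have "eventually P (filtermap snd (net_filter I le)) \<longleftrightarrow> eventually P F" for P
  proof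
    assume "eventually P (filtermap snd (net_filter I le))"
    then obtain A a where i: "(A, a) \<in> I" "\<forall>j\<in>I. le (A, a) j \<longrightarrow> P (snd j)"
      by (auto simp: eventually_filtermap eventually_net_filter[OF dir])
    have "P x" if "x \<in> A" for x
      using i(2)[rule_format, of "(A, x)"] i(1) that by (auto simp: I_def le_def)
    then show "eventually P F"
      using i(1) by (auto simp: I_def elim: eventually_mono)
  next
    assume "eventually P F"
    then have "eventually (\<lambda>x. x \<in> S \<inter> {x. P x}) F"
      using assms(2) by (auto intro: eventually_conj)
    then obtain x where "(S \<inter> {x. P x}, x) \<in> I"
      using ex by blast
    then show "eventually P (filtermap snd (net_filter I le))"
      unfolding eventually_filtermap eventually_net_filter[OF dir]
      by (rule bexI[rotated]) (auto simp: I_def le_def)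
  qed
  then have "filtermap snd (net_filter I le) = F"
    by (auto simp: filter_eq_iff)
  moreover have "snd \<alpha> \<in> S" if "\<alpha> \<in> I" for \<alpha>
    using that by (auto simp: I_def)
  ultimately show ?thesis
    using that[OF dir] by blast
qed

lemma limitin_filtermap: "limitin X g l (filtermap k G) \<longleftrightarrow> limitin X (\<lambda>i. g (k i)) l G"
  by (simp add: limitin_def eventually_filtermap)

text \<open>Tychonoff's theorem: pointwise bounded functions converge pointwise along a finer filter.\<close>

lemma pointwise_convergent_refinement:
  fixes \<Phi> :: "'i \<Rightarrow> 'x \<Rightarrow> real"
  assumes "F \<noteq> bot" "\<And>i x. \<bar>\<Phi> i x\<bar> \<le> c x"
  obtains G h where "G \<noteq> bot" "G \<le> F" "\<And>x. ((\<lambda>i. \<Phi> i x) \<longlongrightarrow> h x) G"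
proof -
  let ?B = "\<Pi>\<^sub>E x\<in>UNIV. {- c x..c x}"
  have "compactin (product_topology (\<lambda>i. euclidean) UNIV) ?B"
    by (subst compactin_PiE) auto
  then have "compact ?B"
    by (simp add: euclidean_product_topology)
  moreover have "eventually (\<lambda>g. g \<in> ?B) (filtermap \<Phi> F)"
    using assms(2) by (auto simp: eventually_filtermap abs_le_iff minus_le_iff intro!: always_eventually)
  moreover have "filtermap \<Phi> F \<noteq> bot"
    using assms(1) by (simp add: filtermap_bot_iff)
  ultimately obtain h where h: "inf (nhds h) (filtermap \<Phi> F) \<noteq> bot"
    unfolding compact_filter by blast
  define G where "G = inf (filtercomap \<Phi> (nhds h)) F"
  have "G \<noteq> bot"
  proof
    assume "G = bot"
    then obtain P Q where P: "eventually P (nhds h)" and Q: "eventually Q F"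
      and PQ: "\<And>i. P (\<Phi> i) \<Longrightarrow> Q i \<Longrightarrow> False"
      by (fastforce simp: G_def trivial_limit_def eventually_inf eventually_filtercomap)
    have "eventually (\<lambda>g. \<not> P g) (filtermap \<Phi> F)"
      using Q PQ by (auto simp: eventually_filtermap elim!: eventually_mono)
    then have "eventually (\<lambda>g. False) (inf (nhds h) (filtermap \<Phi> F))"
      using P unfolding eventually_inf by blast
    then show False
      using h by (simp add: trivial_limit_def)
  qed
  moreover have "((\<lambda>i. \<Phi> i x) \<longlongrightarrow> h x) G" for x
  proof -
    have "filterlim \<Phi> (nhds h) G"
      unfolding G_def by (rule filterlim_mono[OF filterlim_filtercomap]) auto
    moreover have "continuous_on UNIV (\<lambda>g :: 'x \<Rightarrow> real. g x)"
      by (rule continuous_on_product_coordinates)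
    ultimately show ?thesis
      using continuous_on_tendsto_compose[of UNIV "\<lambda>g. g x" \<Phi> h G] by simp
  qed
  ultimately show ?thesis
    using that[of G h] by (simp add: G_def)
qed

section \<open>Order-preserving homogeneous maps and their perturbed eigenvectors\<close>

text \<open>Growth rates squeezed between eigenvalues: \<open>l n\<close> bounds the growth of \<open>p\<close> from above, and for
  fixed \<open>k\<close> the \<open>k\<close>-th power of \<open>l n\<close> is asymptotically bounded by \<open>B * p k\<close>. Then
  \<open>l\<close> and the roots of \<open>p\<close> have the same limit, namely the infimum of \<open>l\<close>.\<close>

lemma root_limit_eq_eigenvalue_limit:
  fixes l p :: "nat \<Rightarrow> real" and s :: "nat \<Rightarrow> nat \<Rightarrow> real"
  assumes c: "c > 0" "\<And>n. c \<le> l n"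
    and A: "\<And>n k. p k \<le> A n * l n ^ k" "\<And>n. A n > 0"
    and B: "B > 0" "\<And>n k. l n ^ k \<le> B * p k * s k n" "\<And>k. s k \<longlonglongrightarrow> 1"
  obtains r where "r > 0" "l \<longlonglongrightarrow> r" "(\<lambda>k. root k (p k)) \<longlonglongrightarrow> r"
proof -
  define r where "r = Inf (range l)"
  have bdd: "bdd_below (range l)"
    using c(2) by (auto intro!: bdd_belowI[of _ c])
  have r_le: "r \<le> l n" for n
    unfolding r_def by (intro cInf_lower bdd) auto
  have "c \<le> r"
    unfolding r_def using c(2) by (intro cInf_greatest) auto
  then have r0: "r > 0"
    using c(1) by linarith
  have l0: "l n > 0" for n
    using c(1) c(2)[of n] by linarith
  have ex: "\<exists>m. l m < r + e" if "e > 0" for e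
    using cInf_lessD[of "range l" "r + e"] that by (auto simp: r_def)
  have Bps: "(\<lambda>n. B * p k * s k n) \<longlonglongrightarrow> B * p k" for k
    using tendsto_mult[OF tendsto_const B(3), of "B * p k" k] by simp
  have root_const_mult: "(\<lambda>k. root k a * y) \<longlonglongrightarrow> y" if "a > 0" for a y :: real
    using tendsto_mult[OF LIMSEQ_root_const[OF that] tendsto_const, of y] by simp
  have l_lim: "l \<longlonglongrightarrow> r"
  proof (rule order_tendstoI)
    show "\<forall>\<^sub>F n in sequentially. a < l n" if "a < r" for a
      using r_le that by (auto intro!: always_eventually intro: less_le_trans)
  next
    fix a assume a: "r < a"
    then obtain m where m: "l m < a"
      using ex[of "a - r"] by auto
    have "\<forall>\<^sub>F k in sequentially. root k (B * A m) * l m < a"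
      using root_const_mult A(2) B(1) m by (intro order_tendstoD(2)[of _ "l m"]) auto
    then have "\<forall>\<^sub>F k in sequentially. root k (B * A m) * l m < a \<and> k > 0"
      using eventually_gt_at_top by (intro eventually_conj)
    then obtain k where k: "root k (B * A m) * l m < a" "k > 0"
      using eventually_happens'[OF sequentially_bot] by blast
    have "B * p k \<le> B * A m * l m ^ k"
      using A(1)[of k m] B(1) by (simp add: mult.assoc)
    also have "\<dots> = (root k (B * A m) * l m) ^ k"
      using k(2) A(2) B(1) by (simp add: power_mult_distrib less_imp_le)
    also have "\<dots> < a ^ k"
      using k l0[of m] A(2)[of m] B(1) by (intro power_strict_mono) (auto simp: less_imp_le)
    finally have "\<forall>\<^sub>F n in sequentially. B * p k * s k n < a ^ k"
      using order_tendstoD(2)[OF Bps] by blast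
    then show "\<forall>\<^sub>F n in sequentially. l n < a"
    proof eventually_elim
      case (elim n)
      then have "l n ^ k < a ^ k"
        using B(2)[where n = n and k = k] by linarith
      then show ?case
        using a r0 by (auto intro: power_less_imp_less_base)
    qed
  qed
  have lower: "r ^ k \<le> B * p k" for k
  proof (rule tendsto_lowerbound[OF Bps])
    have "r ^ k \<le> l n ^ k" for n
      using r_le r0 by (intro power_mono) auto
    then show "\<forall>\<^sub>F n in sequentially. r ^ k \<le> B * p k * s k n"
      using B(2) order_trans by (intro always_eventually) blast
  qed simp
  have p0: "p k > 0" for k
    using lower[of k] r0 B(1) by (metis less_le_trans zero_less_mult_pos zero_less_power)
  have "(\<lambda>k. root k (p k)) \<longlonglongrightarrow> r"
  proof (rule order_tendstoI)
    fix a assume a: "a < r"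
    have "\<forall>\<^sub>F k in sequentially. a < root k (1 / B) * r"
      using root_const_mult B(1) a by (intro order_tendstoD(1)[of _ r]) auto
    then show "\<forall>\<^sub>F k in sequentially. a < root k (p k)"
      using eventually_gt_at_top[of 0]
    proof eventually_elim
      case (elim k)
      have "root k (1 / B) * r = root k (1 / B * r ^ k)"
        using elim(2) r0 by (simp only: real_root_mult real_root_power_cancel less_imp_le)
      also have "\<dots> \<le> root k (p k)"
        using elim(2) lower[of k] B(1) by (simp add: pos_divide_le_eq mult.commute)
      finally show ?case
        using elim(1) by simp
    qed
  next
    fix a assume a: "r < a"
    then obtain m where m: "l m < a"
      using ex[of "a - r"] by auto
    have "\<forall>\<^sub>F k in sequentially. root k (A m) * l m < a"
      using root_const_mult A(2) m by (intro order_tendstoD(2)[of _ "l m"]) auto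
    then show "\<forall>\<^sub>F k in sequentially. root k (p k) < a"
      using eventually_gt_at_top[of 0]
    proof eventually_elim
      case (elim k)
      have "root k (p k) \<le> root k (A m * l m ^ k)"
        using elim(2) A(1) by simp
      also have "\<dots> = root k (A m) * l m"
        using elim(2) l0[of m] by (simp add: real_root_mult real_root_power_cancel)
      finally show ?case
        using elim(1) by simp
    qed
  qed
  then show ?thesis
    using that r0 l_lim by blast
qed

text \<open>The vector \<open>v n\<close> is a normalised eigenvector of the perturbed map, with eigenvalue \<open>l n\<close>; in
  the eigenvalue equation \<open>N (v n)\<close> is replaced by its value 1.\<close>

locale perturbed_eigenvectors = closed_pointed_cone C
  for C :: "'a::real_normed_vector set" +
  fixes f :: "'a \<Rightarrow> 'a" and N :: "'a \<Rightarrow> real" and u :: 'a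
    and \<epsilon> l :: "nat \<Rightarrow> real" and v :: "nat \<Rightarrow> 'a"
  assumes equivalent: "equivalent_norm N" and monotone: "monotone_norm C N"
    and u: "u \<in> interior C" "norm u = 1"
    and f_interior: "\<And>x. x \<in> interior C \<Longrightarrow> f x \<in> interior C"
    and f_order: "order_preserving_on C (interior C) f"
    and f_homogeneous: "homogeneous_on (interior C) f"
    and eps_pos: "\<And>n. \<epsilon> n > 0" and eps_lim: "\<epsilon> \<longlonglongrightarrow> 0"
    and v_interior: "\<And>n. v n \<in> interior C" and v_norm: "\<And>n. N (v n) = 1"
    and eigen: "\<And>n. f (v n) + \<epsilon> n *\<^sub>R u = l n *\<^sub>R v n"
begin

lemma f_mono: "x \<in> interior C \<Longrightarrow> y \<in> interior C \<Longrightarrow> x \<preceq> y \<Longrightarrow> f x \<preceq> f y"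
  using f_order by (auto simp: order_preserving_on_def)

lemma f_scale: "x \<in> interior C \<Longrightarrow> c > 0 \<Longrightarrow> f (c *\<^sub>R x) = c *\<^sub>R f x"
  using f_homogeneous by (auto simp: homogeneous_on_def)

lemma f_le_multiple:
  assumes "x \<in> interior C" "y \<in> interior C" "c > 0" "x \<preceq> c *\<^sub>R y"
  shows "f x \<preceq> c *\<^sub>R f y"
  using f_mono[OF assms(1) interior_scale[OF assms(2,3)] assms(4)] f_scale[OF assms(2,3)] by simp

lemma iterate_interior: "x \<in> interior C \<Longrightarrow> (f ^^ k) x \<in> interior C"
  by (induction k) (auto intro: f_interior)

lemma iterate_le_multiple:
  assumes "x \<in> interior C" "y \<in> interior C" "c > 0" "x \<preceq> c *\<^sub>R y"
  shows "(f ^^ k) x \<preceq> c *\<^sub>R (f ^^ k) y"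
  by (induction k) (use assms in \<open>auto intro: f_le_multiple iterate_interior\<close>)

lemma N_mono: "x \<in> C \<Longrightarrow> x \<preceq> y \<Longrightarrow> N x \<le> N y"
  using monotone by (auto simp: monotone_norm_def zero_le_iff)

lemma N_scale: "c \<ge> 0 \<Longrightarrow> N (c *\<^sub>R x) = c * N x"
  using equivalent by (simp add: equivalent_norm_def)

lemma N_equiv: obtains a b where "a > 0" "b > 0" "\<And>x. a * norm x \<le> N x" "\<And>x. N x \<le> b * norm x"
  using equivalent by (auto simp: equivalent_norm_def)

lemma N_pos: "x \<noteq> 0 \<Longrightarrow> N x > 0"
  using N_equiv by (metis mult_pos_pos order_less_le_trans zero_less_norm_iff)

lemma N_le_M: "x \<in> interior C \<Longrightarrow> y \<in> interior C \<Longrightarrow> N x \<le> M x y * N y"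
  using N_mono[OF interior_in_cone le_M[of y x]] N_scale[of "M x y" y] M_pos_interior[of x y]
  by simp

lemma f_v_le: "f (v n) \<preceq> l n *\<^sub>R v n"
  using pointed_cone_scale[OF pointed interior_in_cone[OF u(1)], of "\<epsilon> n"] eps_pos[of n] eigen[of n]
  by (simp add: cone_le_def flip: eigen)

text \<open>Applying \<open>f\<close> increases the Funk distance to \<open>v n\<close> by at most \<open>ln (l n)\<close>, and decreases the
  reverse Funk distance by at least \<open>ln (l n)\<close> up to an error that vanishes with \<open>\<epsilon> n\<close>.
  Iterated at \<open>u\<close>, the two estimates compare \<open>l n\<close> with the growth of the orbit of \<open>u\<close>; in the
  limit they give the inequalities for horofunctions.\<close>

lemma M_f_left_le:
  assumes "x \<in> interior C"
  shows "M (f x) (v n) \<le> l n * M x (v n)"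
proof (rule M_le[OF v_interior])
  have pos: "M x (v n) > 0"
    using M_pos_interior assms v_interior by blast
  have "f x \<preceq> M x (v n) *\<^sub>R f (v n)"
    using assms pos v_interior by (intro f_le_multiple le_M) auto
  moreover have "M x (v n) *\<^sub>R f (v n) \<preceq> M x (v n) *\<^sub>R l n *\<^sub>R v n"
    using pos f_v_le by (intro le_scale) auto
  ultimately show "f x \<preceq> (l n * M x (v n)) *\<^sub>R v n"
    using le_trans by (fastforce simp: mult.commute)
qed

lemma l_pos: "l n > 0"
proof -
  have "0 < M (f u) (v n)" "0 < M u (v n)"
    using M_pos_interior f_interior u v_interior by blast+
  then show ?thesis
    using M_f_left_le[OF u(1), of n] by (smt (verit) mult_nonneg_nonneg mult_nonpos_nonneg)
qed

lemma M_f_right_le: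
  assumes "x \<in> interior C"
  shows "l n * M (v n) (f x) \<le> M (v n) x * (1 + \<epsilon> n * (M u (f x) * N x))"
proof -
  let ?m = "M (v n) x" and ?c = "M u (f x)"
  have pos: "?m > 0" "?c > 0" "N x > 0"
    using M_pos_interior assms v_interior f_interior u(1) N_pos interior_nonzero by blast+
  \<comment> \<open>The normalisation of \<open>v n\<close> bounds \<open>?m\<close> from below, which makes the additive error
    relative.\<close>
  have "1 \<le> ?m * N x"
    using N_le_M[OF v_interior assms] v_norm by simp
  then have "\<epsilon> n * ?c * 1 \<le> \<epsilon> n * ?c * (?m * N x)"
    using eps_pos[of n] pos by (intro mult_left_mono) auto
  then have c: "?m + \<epsilon> n * ?c \<le> ?m * (1 + \<epsilon> n * (?c * N x))"
    by (simp add: algebra_simps)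
  have "f (v n) + \<epsilon> n *\<^sub>R u \<preceq> ?m *\<^sub>R f x + \<epsilon> n *\<^sub>R ?c *\<^sub>R f x"
    using assms pos v_interior f_interior eps_pos[of n]
    by (intro le_add f_le_multiple le_scale le_M) auto
  then have "l n *\<^sub>R v n \<preceq> (?m + \<epsilon> n * ?c) *\<^sub>R f x"
    by (simp add: eigen scaleR_add_left)
  then have "M (l n *\<^sub>R v n) (f x) \<le> ?m + \<epsilon> n * ?c"
    using assms f_interior by (intro M_le) auto
  then show ?thesis
    using c assms f_interior l_pos by (simp add: M_scale_left)
qed

lemma M_iterate_left_le:
  assumes "x \<in> interior C"
  shows "M ((f ^^ k) x) (v n) \<le> l n ^ k * M x (v n)"
proof (induction k)
  case (Suc k)
  have "M ((f ^^ Suc k) x) (v n) \<le> l n * M ((f ^^ k) x) (v n)"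
    using M_f_left_le[OF iterate_interior[OF assms]] by simp
  also have "\<dots> \<le> l n * (l n ^ k * M x (v n))"
    using Suc l_pos[of n] by (intro mult_left_mono) auto
  finally show ?case
    by (simp add: mult.assoc)
qed simp

lemma error_factor_pos:
  assumes "x \<in> interior C"
  shows "1 + \<epsilon> n * (M u ((f ^^ Suc j) x) * N ((f ^^ j) x)) > 0"
  using M_pos_interior[OF u(1) iterate_interior[OF assms, of "Suc j"]] eps_pos[of n]
    N_pos[OF interior_nonzero[OF iterate_interior[OF assms, of j]]]
  by (intro add_pos_pos mult_pos_pos) auto

lemma M_iterate_right_le:
  assumes "x \<in> interior C"
  shows "l n ^ k * M (v n) ((f ^^ k) x)
    \<le> M (v n) x * (\<Prod>j<k. 1 + \<epsilon> n * (M u ((f ^^ Suc j) x) * N ((f ^^ j) x)))"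
proof (induction k)
  case (Suc k)
  let ?y = "(f ^^ k) x"
  let ?g = "\<lambda>j. 1 + \<epsilon> n * (M u ((f ^^ Suc j) x) * N ((f ^^ j) x))"
  have y: "?y \<in> interior C"
    using iterate_interior[OF assms] .
  have g: "?g k \<ge> 0"
    using error_factor_pos[OF assms] less_imp_le by blast
  have "l n ^ Suc k * M (v n) ((f ^^ Suc k) x) = l n ^ k * (l n * M (v n) (f ?y))"
    by simp
  also have "\<dots> \<le> l n ^ k * (M (v n) ?y * ?g k)"
    using M_f_right_le[OF y, of n] l_pos[of n] by (intro mult_left_mono) auto
  also have "\<dots> = (l n ^ k * M (v n) ?y) * ?g k"
    by (simp only: mult.assoc)
  also have "\<dots> \<le> (M (v n) x * (\<Prod>j<k. ?g j)) * ?g k"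
    using Suc g by (intro mult_right_mono) auto
  finally show ?case
    by (simp add: mult.assoc)
qed simp

text \<open>Up to constants independent of \<open>k\<close>, the partial norm of an iterate is its value at the order
  unit \<open>u\<close>.\<close>

lemma partial_norm_bounds:
  obtains a b where "a > 0" "b > 0"
    "\<And>k. partial_norm C (f ^^ k) \<le> a * N ((f ^^ k) u)"
    "\<And>k. N ((f ^^ k) u) \<le> b * partial_norm C (f ^^ k)"
proof -
  obtain a b where ab: "a > 0" "b > 0" "\<And>x. a * norm x \<le> N x" "\<And>x. N x \<le> b * norm x"
    using N_equiv by blast
  obtain K where K: "K > 0" "\<And>x. x \<preceq> (K * norm x) *\<^sub>R u"
    using order_unit[OF u(1)] by blast
  have bd: "norm ((f ^^ k) x) \<le> K / a * N ((f ^^ k) u)"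
    if x: "x \<in> interior C" "norm x \<le> 1" for x k
  proof -
    have "(K * norm x) *\<^sub>R u \<preceq> K *\<^sub>R u"
      using x K(1) interior_in_cone[OF u(1)] by (intro scale_le_scale) (auto simp: mult_left_le)
    then have "(f ^^ k) x \<preceq> K *\<^sub>R (f ^^ k) u"
      by (rule iterate_le_multiple[OF x(1) u(1) K(1) le_trans[OF K(2)]])
    then have "N ((f ^^ k) x) \<le> N (K *\<^sub>R (f ^^ k) u)"
      by (rule N_mono[OF interior_in_cone[OF iterate_interior[OF x(1)]]])
    also have "\<dots> = K * N ((f ^^ k) u)"
      using K(1) by (intro N_scale) auto
    finally have "a * norm ((f ^^ k) x) \<le> K * N ((f ^^ k) u)"
      by (rule order_trans[OF ab(3)])
    then show ?thesis
      using ab(1) by (simp add: pos_le_divide_eq mult.commute)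
  qed
  have "partial_norm C (f ^^ k) \<le> K / a * N ((f ^^ k) u)" for k
    unfolding partial_norm_def
  proof (rule cSUP_least)
    show "{x \<in> interior C. norm x \<le> 1} \<noteq> {}"
      using u by auto
  qed (use bd in blast)
  moreover have "N ((f ^^ k) u) \<le> b * partial_norm C (f ^^ k)" for k
  proof -
    have "norm ((f ^^ k) u) \<le> partial_norm C (f ^^ k)"
      unfolding partial_norm_def
    proof (rule cSUP_upper)
      show "u \<in> {x \<in> interior C. norm x \<le> 1}"
        using u by simp
      show "bdd_above ((\<lambda>x. norm ((f ^^ k) x)) ` {x \<in> interior C. norm x \<le> 1})"
        using bd by (intro bdd_aboveI2) blast
    qed
    then show ?thesis
      using ab(2) by (intro order_trans[OF ab(4)] mult_left_mono) auto
  qed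
  ultimately show ?thesis
    using that[of "K / a" b] K(1) ab by simp
qed

proposition eigenvalues_tendsto_radius:
  "l \<longlonglongrightarrow> partial_spectral_radius C f" and radius_pos: "partial_spectral_radius C f > 0"
proof -
  obtain a b where ab: "a > 0" "b > 0"
    "\<And>k. partial_norm C (f ^^ k) \<le> a * N ((f ^^ k) u)"
    "\<And>k. N ((f ^^ k) u) \<le> b * partial_norm C (f ^^ k)"
    using partial_norm_bounds by blast
  obtain a' where a': "a' > 0" "\<And>x. a' * norm x \<le> N x"
    using N_equiv by metis
  obtain K where K: "K > 0" "\<And>x. x \<preceq> (K * norm x) *\<^sub>R u"
    using order_unit[OF u(1)] by blast
  define s where
    "s k n = (\<Prod>j<k. 1 + \<epsilon> n * (M u ((f ^^ Suc j) u) * N ((f ^^ j) u)))" for k n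
  let ?p = "\<lambda>k. partial_norm C (f ^^ k)"
  have Mu: "M u (f u) > 0" and Muv: "M u (v n) > 0" "M (v n) ((f ^^ k) u) > 0" for n k
    using M_pos_interior u f_interior v_interior iterate_interior by blast+
  have "1 / M u (f u) \<le> l n" for n
  proof -
    have "M u (v n) \<le> M u (f u) * M (f u) (v n)"
      using M_trans u f_interior v_interior interior_in_cone interior_nonzero by blast
    also have "\<dots> \<le> M u (f u) * (l n * M u (v n))"
      using M_f_left_le[OF u(1)] Mu by (intro mult_left_mono) auto
    finally have "M u (v n) * 1 \<le> M u (v n) * (M u (f u) * l n)"
      by (simp add: mult_ac)
    then have "1 \<le> M u (f u) * l n"
      using Muv(1)[of n] by (rule mult_left_le_imp_le)
    then show ?thesis
      using Mu by (simp add: field_simps)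
  qed
  moreover have "?p k \<le> (a * M u (v n)) * l n ^ k" for n k
  proof -
    have "N ((f ^^ k) u) \<le> M ((f ^^ k) u) (v n)"
      using N_le_M[OF iterate_interior[OF u(1)] v_interior] v_norm by simp
    also have "\<dots> \<le> l n ^ k * M u (v n)"
      by (rule M_iterate_left_le[OF u(1)])
    finally have "a * N ((f ^^ k) u) \<le> a * (l n ^ k * M u (v n))"
      using ab(1) by (intro mult_left_mono) auto
    then show ?thesis
      using ab(3)[of k] by (simp add: mult_ac)
  qed
  moreover have "l n ^ k \<le> (K / a' * b) * ?p k * s k n" for n k
  proof -
    have s0: "s k n \<ge> 0"
      unfolding s_def using error_factor_pos[OF u(1)] less_imp_le by (intro prod_nonneg) blast
    have N0: "N ((f ^^ k) u) > 0"
      using N_pos interior_nonzero iterate_interior u by blast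
    have "norm (v n) \<le> 1 / a'"
      using a'(1) a'(2)[of "v n"] v_norm by (simp add: field_simps)
    then have "K * norm (v n) \<le> K * (1 / a')"
      using K(1) by (intro mult_left_mono) auto
    then have Mv: "M (v n) u \<le> K / a'"
      using M_le[OF u(1) K(2)] by (auto intro: order_trans)
    have "1 \<le> M (v n) ((f ^^ k) u) * N ((f ^^ k) u)"
      using N_le_M[OF v_interior iterate_interior[OF u(1)]] v_norm by simp
    then have "l n ^ k * 1 \<le> l n ^ k * (M (v n) ((f ^^ k) u) * N ((f ^^ k) u))"
      using l_pos[of n] by (intro mult_left_mono) auto
    also have "\<dots> = (l n ^ k * M (v n) ((f ^^ k) u)) * N ((f ^^ k) u)"
      by (simp only: mult.assoc)
    also have "\<dots> \<le> (M (v n) u * s k n) * N ((f ^^ k) u)"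
      using M_iterate_right_le[OF u(1), of n k] N0
      by (intro mult_right_mono) (simp_all only: s_def less_imp_le)
    also have "\<dots> \<le> (K / a' * s k n) * (b * ?p k)"
      using Mv s0 ab(4)[of k] N0 a'(1) K(1) by (intro mult_mono mult_right_mono) auto
    finally show ?thesis
      by (simp add: mult_ac)
  qed
  moreover have "s k \<longlonglongrightarrow> 1" for k
  proof -
    have "s k \<longlonglongrightarrow> (\<Prod>j<k. 1 + 0 * (M u ((f ^^ Suc j) u) * N ((f ^^ j) u)))"
      unfolding s_def by (intro tendsto_intros eps_lim)
    then show ?thesis by simp
  qed
  moreover have "1 / M u (f u) > 0" "K / a' * b > 0" "a * M u (v n) > 0" for n
    using Mu Muv K a' ab by simp_all
  ultimately obtain r where r: "r > 0" "l \<longlonglongrightarrow> r" "(\<lambda>k. root k (?p k)) \<longlonglongrightarrow> r"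
    using root_limit_eq_eigenvalue_limit[where l = l and p = ?p and s = s and c = "1 / M u (f u)"
        and A = "\<lambda>n. a * M u (v n)" and B = "K / a' * b"] by metis
  then have "partial_spectral_radius C f = r"
    unfolding partial_spectral_radius_def by (intro limI)
  then show "l \<longlonglongrightarrow> partial_spectral_radius C f" "partial_spectral_radius C f > 0"
    using r by simp_all
qed

lemma M_limit_f_le:
  assumes v: "v \<longlonglongrightarrow> w" and x: "x \<in> interior C"
  shows "partial_spectral_radius C f * M w (f x) \<le> M w x"
proof -
  have "(\<lambda>n. l n * M (v n) (f x)) \<longlonglongrightarrow> partial_spectral_radius C f * M w (f x)"
    using M_tendsto_left[OF v f_interior[OF x]] eigenvalues_tendsto_radius by (intro tendsto_mult)
  moreover have "(\<lambda>n. M (v n) x * (1 + \<epsilon> n * (M u (f x) * N x)))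
      \<longlonglongrightarrow> M w x * (1 + 0 * (M u (f x) * N x))"
    by (intro tendsto_intros M_tendsto_left v x eps_lim)
  ultimately have "partial_spectral_radius C f * M w (f x) \<le> M w x * (1 + 0 * (M u (f x) * N x))"
    by (rule LIMSEQ_le) (use M_f_right_le[OF x] in blast)
  then show ?thesis
    by simp
qed

text \<open>An interior limit \<open>w\<close> of the \<open>v n\<close> would satisfy \<open>f w = r w\<close> with \<open>r\<close> the partial spectral
  radius: one inequality is the limit of \<open>f (v n) \<preceq> l n v n\<close>, where \<open>v n\<close> dominates multiples of
  \<open>w\<close> with factors tending to 1, and the other is the limit estimate for \<open>M\<close> at \<open>w\<close>.\<close>

lemma limit_in_frontier:
  assumes v: "v \<longlonglongrightarrow> w" and no_eigenvector: "\<not> (\<exists>x\<in>interior C. is_eigenvector f x)"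
  shows "w \<in> frontier C" "N w = 1"
proof -
  let ?r = "partial_spectral_radius C f"
  obtain a b where ab: "a > 0" "b > 0" "\<And>x. a * norm x \<le> N x" "\<And>x. N x \<le> b * norm x"
    using N_equiv by blast
  have tri: "N (x + y) \<le> N x + N y" for x y
    using equivalent by (simp add: equivalent_norm_def)
  have norm_lim: "(\<lambda>n. norm (w - v n)) \<longlonglongrightarrow> 0"
    using tendsto_norm_zero[OF LIM_zero[OF v]] by (simp add: norm_minus_commute)
  have N_lim: "(\<lambda>n. y + b * norm (w - v n)) \<longlonglongrightarrow> y" for y
    using tendsto_add[OF tendsto_const tendsto_mult_right_zero[OF norm_lim], of y b] by simp
  have "N w \<le> 1 + b * norm (w - v n)" for n
    using tri[of "v n" "w - v n"] ab(4)[of "w - v n"] v_norm[of n] by simp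
  then have "N w \<le> 1"
    by (intro LIMSEQ_le_const[OF N_lim]) auto
  moreover have "1 \<le> N w + b * norm (w - v n)" for n
    using tri[of w "v n - w"] ab(4)[of "v n - w"] v_norm[of n] by (simp add: norm_minus_commute)
  then have "1 \<le> N w"
    by (intro LIMSEQ_le_const[OF N_lim]) auto
  ultimately show "N w = 1" by simp
  have "w \<in> C"
    using closed_sequentially[OF closed _ v] v_interior interior_in_cone by blast
  moreover have "w \<notin> interior C"
  proof
    assume w: "w \<in> interior C"
    have "f w \<preceq> ?r *\<^sub>R w"
    proof -
      obtain K where K: "K > 0" "\<And>x. x \<preceq> (K * norm x) *\<^sub>R w"
        using order_unit[OF w] by blast
      define \<eta> where "\<eta> n = K * norm (w - v n)" for n
      have \<eta>: "\<eta> \<longlonglongrightarrow> 0"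
        unfolding \<eta>_def using norm_lim by (rule tendsto_mult_right_zero)
      have "l n *\<^sub>R v n - (1 - \<eta> n) *\<^sub>R f w \<in> C" if "\<eta> n < 1" for n
      proof -
        have "(1 - \<eta> n) *\<^sub>R w \<preceq> v n"
          using K(2)[of "w - v n"] by (simp add: cone_le_def \<eta>_def algebra_simps)
        then have "f ((1 - \<eta> n) *\<^sub>R w) \<preceq> f (v n)"
          using that w v_interior by (intro f_mono interior_scale) auto
        then have "(1 - \<eta> n) *\<^sub>R f w \<preceq> l n *\<^sub>R v n"
          using le_trans[OF _ f_v_le] f_scale[OF w, of "1 - \<eta> n"] that by simp
        then show ?thesis
          by (simp add: cone_le_def)
      qed
      then have "\<forall>\<^sub>F n in sequentially. l n *\<^sub>R v n - (1 - \<eta> n) *\<^sub>R f w \<in> C"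
        using order_tendstoD(2)[OF \<eta>, of 1] by (auto elim: eventually_mono)
      moreover have "(\<lambda>n. l n *\<^sub>R v n - (1 - \<eta> n) *\<^sub>R f w) \<longlonglongrightarrow> ?r *\<^sub>R w - (1 - 0) *\<^sub>R f w"
        by (intro tendsto_intros eigenvalues_tendsto_radius v \<eta>)
      ultimately have "?r *\<^sub>R w - (1 - 0) *\<^sub>R f w \<in> C"
        by (rule Lim_in_closed_set[OF closed _ sequentially_bot])
      then show ?thesis
        by (simp add: cone_le_def)
    qed
    moreover have "?r *\<^sub>R w \<preceq> f w"
    proof -
      have "M (?r *\<^sub>R w) (f w) \<le> 1"
        using M_limit_f_le[OF v w] M_self[OF w] M_scale_left[OF f_interior[OF w] radius_pos]
        by simp
      then have "M (?r *\<^sub>R w) (f w) *\<^sub>R f w \<preceq> 1 *\<^sub>R f w"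
        using f_interior[OF w] interior_in_cone by (intro scale_le_scale) auto
      then show ?thesis
        using le_trans[OF le_M[OF f_interior[OF w]]] by fastforce
    qed
    ultimately have "f w = ?r *\<^sub>R w"
      by (rule le_antisym)
    then show False
      using no_eigenvector w interior_nonzero by (auto simp: is_eigenvector_def)
  qed
  ultimately show "w \<in> frontier C"
    using closed by (simp add: frontier_def closure_closed)
qed

end

section \<open>Horofunctions at a boundary point of the cone\<close>

context closed_pointed_cone
begin

lemma add_interior: "w \<in> C \<Longrightarrow> b \<in> interior C \<Longrightarrow> \<delta> > 0 \<Longrightarrow> w + \<delta> *\<^sub>R b \<in> interior C"
  by (rule interior_upward[OF interior_scale]) (auto simp: cone_le_def)

lemma frontier_iff: "w \<in> frontier C \<longleftrightarrow> w \<in> C \<and> w \<notin> interior C"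
  using closed by (simp add: frontier_def)

text \<open>If the \<open>v i\<close> approach a boundary point \<open>w\<close>, then their limiting Funk function tends to
  minus infinity at \<open>w + \<delta> b\<close> as \<open>\<delta>\<close> tends to 0. With \<open>\<eta> i\<close> comparing \<open>w\<close> and \<open>v i\<close> in
  units of \<open>b\<close>, the point is that \<open>1 \<le> M b (v i) * \<eta> i\<close>, since otherwise \<open>w\<close> would dominate a positive multiple of \<open>b\<close>.\<close>

lemma Funk_horofunction_near_boundary_point:
  assumes b: "b \<in> interior C" and w: "w \<in> frontier C" and G: "G \<noteq> bot"
    and v: "\<And>i. v i \<in> interior C" "(v \<longlongrightarrow> w) G"
    and t: "((\<lambda>i. Funk C (w + \<delta> *\<^sub>R b) (v i) - Funk C b (v i)) \<longlongrightarrow> t) G" and "\<delta> > 0"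
  shows "t \<le> ln \<delta>"
proof -
  obtain K where K: "K > 0" "\<And>x. x \<preceq> (K * norm x) *\<^sub>R b"
    using order_unit[OF b] by blast
  define \<eta> where "\<eta> i = K * norm (v i - w)" for i
  have \<eta>_lim: "(\<eta> \<longlongrightarrow> 0) G"
    unfolding \<eta>_def using tendsto_norm_zero[OF LIM_zero[OF v(2)]] by (rule tendsto_mult_right_zero)
  have \<eta>0: "\<eta> i \<ge> 0" for i
    using K(1) by (simp add: \<eta>_def)
  have x: "w + \<delta> *\<^sub>R b \<in> interior C"
    using add_interior w b \<open>\<delta> > 0\<close> frontier_iff by blast
  have "Funk C (w + \<delta> *\<^sub>R b) (v i) - Funk C b (v i) \<le> ln (2 * \<eta> i + \<delta>)" for i
  proof -
    let ?m = "M b (v i)"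
    have m: "?m > 0"
      using M_pos_interior[OF b v(1)] .
    have bv: "b \<preceq> ?m *\<^sub>R v i"
      using le_M[OF v(1)] .
    have "1 \<le> ?m * \<eta> i"
    proof (rule ccontr)
      assume less: "\<not> 1 \<le> ?m * \<eta> i"
      have "v i \<preceq> w + \<eta> i *\<^sub>R b"
        using K(2)[of "v i - w"] by (simp add: cone_le_def \<eta>_def algebra_simps)
      then have "?m *\<^sub>R v i \<preceq> ?m *\<^sub>R (w + \<eta> i *\<^sub>R b)"
        using m by (intro le_scale) auto
      then have "b \<preceq> ?m *\<^sub>R (w + \<eta> i *\<^sub>R b)"
        using le_trans[OF bv] by blast
      then have "(1 - ?m * \<eta> i) *\<^sub>R b \<preceq> ?m *\<^sub>R w"
        by (simp add: cone_le_def algebra_simps)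
      then have "?m *\<^sub>R w \<in> interior C"
        using less by (intro interior_upward[OF interior_scale[OF b, of "1 - ?m * \<eta> i"]]) auto
      then have "w \<in> interior C"
        using interior_scale[of "?m *\<^sub>R w" "1 / ?m"] m by simp
      then show False
        using w by (simp add: frontier_iff)
    qed
    then have "1 + (\<eta> i + \<delta>) * ?m \<le> (2 * \<eta> i + \<delta>) * ?m"
      by (simp add: algebra_simps)
    moreover have "M (w + \<delta> *\<^sub>R b) (v i) \<le> 1 + (\<eta> i + \<delta>) * ?m"
    proof (rule M_le[OF v(1)])
      have "w - v i \<preceq> \<eta> i *\<^sub>R b"
        using K(2)[of "w - v i"] by (simp add: \<eta>_def norm_minus_commute)
      then have "w + \<delta> *\<^sub>R b \<preceq> v i + (\<eta> i + \<delta>) *\<^sub>R b"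
        by (simp add: cone_le_def algebra_simps)
      moreover have "v i + (\<eta> i + \<delta>) *\<^sub>R b \<preceq> v i + (\<eta> i + \<delta>) *\<^sub>R ?m *\<^sub>R v i"
        using \<eta>0[of i] \<open>\<delta> > 0\<close> by (intro le_add le_refl le_scale bv) auto
      ultimately have "w + \<delta> *\<^sub>R b \<preceq> v i + (\<eta> i + \<delta>) *\<^sub>R ?m *\<^sub>R v i"
        using le_trans by blast
      then show "w + \<delta> *\<^sub>R b \<preceq> (1 + (\<eta> i + \<delta>) * ?m) *\<^sub>R v i"
        by (simp only: scaleR_add_left scaleR_one scaleR_scaleR)
    qed
    ultimately have "M (w + \<delta> *\<^sub>R b) (v i) \<le> (2 * \<eta> i + \<delta>) * ?m"
      by linarith
    then have "ln (M (w + \<delta> *\<^sub>R b) (v i)) \<le> ln ((2 * \<eta> i + \<delta>) * ?m)"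
      using M_pos_interior[OF x v(1)] by (intro ln_mono)
    also have "\<dots> = ln (2 * \<eta> i + \<delta>) + ln ?m"
      using \<eta>0[of i] \<open>\<delta> > 0\<close> m by (intro ln_mult_pos) auto
    finally show ?thesis
      by (simp add: Funk_def)
  qed
  moreover have "((\<lambda>i. ln (2 * \<eta> i + \<delta>)) \<longlongrightarrow> ln (2 * 0 + \<delta>)) G"
    using \<open>\<delta> > 0\<close> by (intro tendsto_intros \<eta>_lim) auto
  ultimately have "t \<le> ln (2 * 0 + \<delta>)"
    by (intro tendsto_le[OF G _ t]) auto
  then show ?thesis
    by simp
qed

text \<open>No translate of the Funk or Hilbert distance to an interior point behaves like this.\<close>

lemma not_Funk_embed:
  assumes b: "b \<in> interior C" and w: "w \<in> C" "w \<noteq> 0"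
    and h: "\<And>\<delta>. \<delta> > 0 \<Longrightarrow> h (w + \<delta> *\<^sub>R b) \<le> ln \<delta>"
  shows "h \<notin> horo_embed C b (Funk C) ` interior C"
proof
  assume "h \<in> horo_embed C b (Funk C) ` interior C"
  then obtain z where z: "z \<in> interior C" "h = horo_embed C b (Funk C) z"
    by blast
  define \<delta> where "\<delta> = exp (ln (M w z) - Funk C b z - 1)"
  have \<delta>: "\<delta> > 0"
    by (simp add: \<delta>_def)
  have "M w z \<le> M (w + \<delta> *\<^sub>R b) z"
    using z(1) pointed_cone_scale[OF pointed interior_in_cone[OF b], of \<delta>] \<delta>
    by (intro M_mono_left) (auto simp: cone_le_def)
  then have "ln (M w z) \<le> Funk C (w + \<delta> *\<^sub>R b) z"
    unfolding Funk_def using M_pos[OF w z(1)] by (intro ln_mono)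
  then show False
    using h[OF \<delta>] add_interior[OF w(1) b \<delta>] z(2) by (simp add: horo_embed_def \<delta>_def)
qed

lemma not_Hilbert_embed:
  assumes b: "b \<in> interior C" and w: "w \<in> C"
    and h: "\<And>\<delta>. \<delta> > 0 \<Longrightarrow> h (w + \<delta> *\<^sub>R b) \<le> ln \<delta> + c"
  shows "h \<notin> horo_embed C b (Hilbert C) ` interior C"
proof
  assume "h \<in> horo_embed C b (Hilbert C) ` interior C"
  then obtain z where z: "z \<in> interior C" "h = horo_embed C b (Hilbert C) z"
    by blast
  define \<delta> where "\<delta> = exp (- Hilbert C b z - c - 1)"
  have \<delta>: "\<delta> > 0"
    by (simp add: \<delta>_def)
  show False
    using h[OF \<delta>] add_interior[OF w(1) b \<delta>] z(2) Hilbert_nonneg[OF add_interior[OF w(1) b \<delta>] z(1)]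
    by (simp add: horo_embed_def \<delta>_def)
qed

text \<open>The reverse Funk function of \<open>w\<close> determines the ray through \<open>w\<close>: after rescaling, \<open>w\<close> and
  \<open>z\<close> lie below the same interior points, so each lies below the other.\<close>

lemma RFunk_boundary_not_embed:
  assumes b: "b \<in> interior C" and w: "w \<in> frontier C" "w \<noteq> 0"
  shows "horo_embed C b (RFunk C) w \<notin> horo_embed C b (RFunk C) ` interior C"
proof
  assume "horo_embed C b (RFunk C) w \<in> horo_embed C b (RFunk C) ` interior C"
  then obtain z where z: "z \<in> interior C" "horo_embed C b (RFunk C) w = horo_embed C b (RFunk C) z"
    by blast
  have wC: "w \<in> C"
    using w(1) frontier_iff by blast
  have pos: "M w x > 0" "M z x > 0" if "x \<in> interior C" for x
    using M_pos[OF wC w(2) that] M_pos_interior[OF z(1) that] by simp_all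
  define c where "c = M w b / M z b"
  have c: "c > 0"
    using pos[OF b] by (simp add: c_def)
  have Mw: "M w x = M (c *\<^sub>R z) x" if x: "x \<in> interior C" for x
  proof -
    have "ln (M w x) - ln (M w b) = ln (M z x) - ln (M z b)"
      using fun_cong[OF z(2), of x] x by (simp add: horo_embed_def RFunk_def)
    then have "ln (M w x) = ln (c * M z x)"
      using pos[OF x] pos[OF b] by (simp add: c_def ln_mult ln_div)
    then show ?thesis
      using pos[OF x] c M_scale_left[OF x c] by simp
  qed
  have "w \<preceq> c *\<^sub>R z"
    using le_M[OF z(1), of w] Mw[OF z(1)] M_scale_left[OF z(1) c] M_self[OF z(1)] by simp
  moreover have "c *\<^sub>R z \<preceq> w"
  proof -
    have "w + (1 / real (Suc n)) *\<^sub>R b - c *\<^sub>R z \<in> C" for n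
    proof -
      let ?x = "w + (1 / real (Suc n)) *\<^sub>R b"
      have x: "?x \<in> interior C"
        using add_interior[OF wC b] by simp
      have "w \<preceq> 1 *\<^sub>R ?x"
        using pointed_cone_scale[OF pointed interior_in_cone[OF b], of "1 / real (Suc n)"]
        by (simp add: cone_le_def)
      then have "M (c *\<^sub>R z) ?x \<le> 1"
        using M_le[OF x] Mw[OF x] by metis
      then have "M (c *\<^sub>R z) ?x *\<^sub>R ?x \<preceq> 1 *\<^sub>R ?x"
        using x interior_in_cone by (intro scale_le_scale) auto
      then have "c *\<^sub>R z \<preceq> 1 *\<^sub>R ?x"
        by (rule le_trans[OF le_M[OF x]])
      then show ?thesis
        by (simp add: cone_le_def)
    qed
    moreover have "(\<lambda>n. w + (1 / real (Suc n)) *\<^sub>R b - c *\<^sub>R z) \<longlonglongrightarrow> w + 0 *\<^sub>R b - c *\<^sub>R z"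
      by (intro tendsto_intros LIMSEQ_Suc[OF lim_1_over_n])
    ultimately have "w + 0 *\<^sub>R b - c *\<^sub>R z \<in> C"
      by (rule closed_sequentially[OF closed])
    then show ?thesis
      by (simp add: cone_le_def)
  qed
  ultimately have "w = c *\<^sub>R z"
    by (rule le_antisym)
  then show False
    using interior_scale[OF z(1) c] w(1) frontier_iff by blast
qed

text \<open>The point \<open>y\<close> is \<open>w\<close> rescaled so that the reverse Funk distance from \<open>b\<close> is 0.\<close>

lemma RFunk_eq_embed:
  assumes b: "b \<in> interior C" and w: "w \<in> frontier C" "w \<noteq> 0"
  shows "\<exists>y\<in>frontier C - {0}. \<forall>x\<in>interior C. horo_embed C b (RFunk C) w x = RFunk C x y"
proof -
  have wC: "w \<in> C" "w \<notin> interior C"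
    using w(1) frontier_iff by auto
  have m: "M w b > 0"
    using M_pos[OF wC(1) w(2) b] .
  define y where "y = (1 / M w b) *\<^sub>R w"
  have "y \<in> C"
    unfolding y_def using m wC by (intro pointed_cone_scale[OF pointed]) auto
  moreover have "y \<notin> interior C"
    using interior_scale[of y "M w b"] m wC by (auto simp: y_def)
  ultimately have "y \<in> frontier C - {0}"
    using w(2) m by (simp add: frontier_iff y_def)
  moreover have "horo_embed C b (RFunk C) w x = RFunk C x y" if x: "x \<in> interior C" for x
    using x m M_pos[OF wC(1) w(2) x] M_scale_left[OF x, of "1 / M w b" w]
    by (simp add: horo_embed_def RFunk_def y_def ln_div)
  ultimately show ?thesis by blast
qed

lemma RFunk_tendsto:
  assumes "(v \<longlongrightarrow> w) G" "x \<in> interior C" "w \<in> C" "w \<noteq> 0"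
  shows "((\<lambda>i. RFunk C x (v i)) \<longlongrightarrow> RFunk C x w) G"
  unfolding RFunk_def using M_pos[OF assms(3,4,2)]
  by (intro tendsto_ln M_tendsto_left assms(1,2)) auto

lemma limitin_horo_space:
  assumes G: "G \<noteq> bot" and b: "b \<in> interior C" and v: "\<And>i. v i \<in> interior C"
    and \<rho>: "\<And>x x' y. x \<in> interior C \<Longrightarrow> x' \<in> interior C \<Longrightarrow> y \<in> interior C
        \<Longrightarrow> \<bar>\<rho> x y - \<rho> x' y\<bar> \<le> L * Thompson C x x'"
    and h: "h \<in> extensional (interior C)"
      "\<And>x. x \<in> interior C \<Longrightarrow> ((\<lambda>i. \<rho> x (v i) - \<rho> b (v i)) \<longlongrightarrow> h x) G"
  shows "limitin (horo_space C) (\<lambda>i. horo_embed C b \<rho> (v i)) h G"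
    and "h \<in> horo_space C closure_of (horo_embed C b \<rho> ` interior C)"
proof -
  interpret Metric_space "interior C" "Thompson C"
    using Metric_space_Thompson[OF pointed closed zero_not_interior] .
  have ext: "horo_embed C b \<rho> y \<in> extensional (interior C)" for y
    by (simp add: horo_embed_def)
  have Lip: "\<bar>horo_embed C b \<rho> y x - horo_embed C b \<rho> y x'\<bar> \<le> L * Thompson C x x'"
    if "x \<in> interior C" "x' \<in> interior C" "y \<in> interior C" for x x' y
    using \<rho>[OF that] that by (simp add: horo_embed_def)
  show lim: "limitin (horo_space C) (\<lambda>i. horo_embed C b \<rho> (v i)) h G"
    unfolding horo_space_def
  proof (rule Lipschitz_limitin_compact_conv[OF G])
    show "((\<lambda>i. horo_embed C b \<rho> (v i) x) \<longlongrightarrow> h x) G" if "x \<in> interior C" for x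
      using h(2)[OF that] that by (simp add: horo_embed_def)
    show "\<bar>horo_embed C b \<rho> (v i) x - horo_embed C b \<rho> (v i) x'\<bar> \<le> L * Thompson C x x'"
      if "x \<in> interior C" "x' \<in> interior C" for i x x'
      by (rule Lip[OF that v])
  qed (rule ext h(1))+
  have "horo_embed C b \<rho> ` interior C \<subseteq> topspace (horo_space C)"
    using Lipschitz_cont_functions[OF ext Lip]
    by (auto simp: horo_space_def topspace_compact_conv_topology)
  then have "horo_embed C b \<rho> ` interior C \<subseteq> horo_space C closure_of (horo_embed C b \<rho> ` interior C)"
    by (rule closure_of_subset)
  then show "h \<in> horo_space C closure_of (horo_embed C b \<rho> ` interior C)"
    using v G by (intro limitin_closedin[OF lim closedin_closure_of]) (auto intro: always_eventually)
qed

end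

section \<open>Horofunctions that decrease along the map\<close>

theorem theorem6p1:
  fixes C :: "'a::banach set"
    and f :: "'a \<Rightarrow> 'a"
    and N :: "'a \<Rightarrow> real"
    and u b :: 'a
  assumes "pointed_cone C" and "closed C" and "normal_cone C" and "interior C \<noteq> {}"
    and "equivalent_norm N" and "monotone_norm C N"
    and "u \<in> interior C" and "norm u = 1"
    and "b \<in> interior C"
    and "f ` interior C \<subseteq> interior C"
    and "order_preserving_on C (interior C) f"
    and "homogeneous_on (interior C) f"
    and "\<not> (\<exists>x\<in>interior C. is_eigenvector f x)"
    and "converging_approx_eigenvectors C N u f"
  shows "\<exists>(I :: ('a set \<times> 'a) set) le (w :: 'a set \<times> 'a \<Rightarrow> 'a) v h\<^sub>F h\<^sub>R h\<^sub>H.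
     directed_preorder I le \<and>
     (\<forall>\<alpha>\<in>I. w \<alpha> \<in> interior C) \<and>
     (w \<longlongrightarrow> v) (net_filter I le) \<and> v \<in> frontier C \<and> N v = 1 \<and>
     limitin (horo_space C) (\<lambda>\<alpha>. horo_embed C b (Funk C) (w \<alpha>)) h\<^sub>F (net_filter I le) \<and>
     h\<^sub>F \<in> horo_boundary C b (Funk C) \<and>
     limitin (horo_space C) (\<lambda>\<alpha>. horo_embed C b (RFunk C) (w \<alpha>)) h\<^sub>R (net_filter I le) \<and>
     h\<^sub>R \<in> horo_boundary C b (RFunk C) \<and>
     limitin (horo_space C) (\<lambda>\<alpha>. horo_embed C b (Hilbert C) (w \<alpha>)) h\<^sub>H (net_filter I le) \<and>
     h\<^sub>H \<in> horo_boundary C b (Hilbert C) \<and>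
     (\<forall>x\<in>interior C. h\<^sub>H x = h\<^sub>F x + h\<^sub>R x) \<and>
     (\<forall>x\<in>interior C. h\<^sub>F (f x) \<le> h\<^sub>F x + ln (partial_spectral_radius C f)) \<and>
     (\<forall>x\<in>interior C. h\<^sub>R (f x) \<le> h\<^sub>R x - ln (partial_spectral_radius C f)) \<and>
     (\<forall>x\<in>interior C. h\<^sub>H (f x) \<le> h\<^sub>H x) \<and>
     (\<exists>y\<in>frontier C - {0}. \<forall>x\<in>interior C. h\<^sub>R x = RFunk C x y)"
proof -
  have zero: "0 \<notin> interior C"
  proof
    assume "0 \<in> interior C"
    then obtain e where e: "e > 0" "ball 0 e \<subseteq> C"
      using mem_interior by blast
    then have "(e / 2) *\<^sub>R u \<in> C" "- ((e / 2) *\<^sub>R u) \<in> C"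
      using \<open>norm u = 1\<close> by (auto intro!: subsetD[OF e(2)])
    then show False
      using pointed_cone_eq_0[OF \<open>pointed_cone C\<close>] e(1) \<open>norm u = 1\<close> by fastforce
  qed
  obtain \<epsilon> v where \<epsilon>: "\<And>n::nat. 0 < \<epsilon> n" "\<epsilon> \<longlonglongrightarrow> 0"
    and v: "\<And>n. is_approx_eigenvector C N u f (\<epsilon> n) (v n)" and conv: "convergent v"
    using \<open>converging_approx_eigenvectors C N u f\<close>
    unfolding converging_approx_eigenvectors_def by blast
  obtain w where w: "v \<longlonglongrightarrow> w"
    using conv unfolding convergent_def by blast
  have v1: "v n \<in> interior C" "N (v n) = 1" for n
    using v unfolding is_approx_eigenvector_def by auto
  have "\<exists>c. f (v n) + \<epsilon> n *\<^sub>R u = c *\<^sub>R v n" for n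
    using v[of n] unfolding is_approx_eigenvector_def is_eigenvector_def perturbed_map_def by auto
  then obtain l where l: "\<And>n. f (v n) + \<epsilon> n *\<^sub>R u = l n *\<^sub>R v n"
    by metis
  interpret perturbed_eigenvectors C f N u \<epsilon> l v
    by unfold_locales (use assms zero \<epsilon> v1 l in auto)
  let ?r = "partial_spectral_radius C f"
  note b = \<open>b \<in> interior C\<close>
  have w_frontier: "w \<in> frontier C" and Nw: "N w = 1"
    using limit_in_frontier[OF w] assms by blast+
  have w0: "w \<noteq> 0"
    using Nw N_scale[of 0 0] by auto
  have wC: "w \<in> C"
    using w_frontier frontier_iff by blast
  \<comment> \<open>Only the Funk functions need a compactness argument; the reverse Funk functions converge
    along the whole sequence.\<close>
  define \<Phi> where "\<Phi> n x = (if x \<in> interior C then Funk C x (v n) - Funk C b (v n) else 0)" for n x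
  have "\<bar>\<Phi> n x\<bar> \<le> Thompson C x b" for n x
    using Funk_Lipschitz[OF _ b v1(1)] by (auto simp: \<Phi>_def Thompson_def)
  then obtain G h where G: "G \<noteq> bot" "G \<le> sequentially"
    and \<Phi>: "\<And>x. ((\<lambda>n. \<Phi> n x) \<longlongrightarrow> h x) G"
    using pointwise_convergent_refinement[OF sequentially_bot, of \<Phi> "\<lambda>x. Thompson C x b"] by blast
  have h: "((\<lambda>n. Funk C x (v n) - Funk C b (v n)) \<longlongrightarrow> h x) G" if "x \<in> interior C" for x
    using \<Phi>[of x] that by (simp add: \<Phi>_def)
  have w_G: "(v \<longlongrightarrow> w) G" and l_G: "(l \<longlongrightarrow> ?r) G"
    by (rule tendsto_mono[OF G(2) w], rule tendsto_mono[OF G(2) eigenvalues_tendsto_radius])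
  define hF where "hF = restrict h (interior C)"
  define hR where "hR = horo_embed C b (RFunk C) w"
  define hH where "hH = (\<lambda>x\<in>interior C. hF x + hR x)"
  have F_lim: "((\<lambda>n. Funk C x (v n) - Funk C b (v n)) \<longlongrightarrow> hF x) G" if "x \<in> interior C" for x
    using h[OF that] that by (simp add: hF_def)
  have R_lim: "((\<lambda>n. RFunk C x (v n) - RFunk C b (v n)) \<longlongrightarrow> hR x) G" if "x \<in> interior C" for x
    using tendsto_diff[OF RFunk_tendsto RFunk_tendsto, OF w_G that wC w0 w_G b wC w0] that
    by (simp add: hR_def horo_embed_def)
  have H_lim: "((\<lambda>n. Hilbert C x (v n) - Hilbert C b (v n)) \<longlongrightarrow> hH x) G" if "x \<in> interior C" for x
    using tendsto_add[OF F_lim R_lim, OF that that] that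
    by (simp add: hH_def Hilbert_def algebra_simps)
  have ext: "hF \<in> extensional (interior C)" "hR \<in> extensional (interior C)"
    "hH \<in> extensional (interior C)"
    by (auto simp: hF_def hR_def hH_def horo_embed_def)
  have F_Lip: "\<bar>Funk C x y - Funk C x' y\<bar> \<le> 1 * Thompson C x x'"
    and R_Lip: "\<bar>RFunk C x y - RFunk C x' y\<bar> \<le> 1 * Thompson C x x'"
    if "x \<in> interior C" "x' \<in> interior C" "y \<in> interior C" for x x' y
    using Funk_Lipschitz[OF that] RFunk_Lipschitz[OF that(1,2) interior_in_cone interior_nonzero] that
    by simp_all
  have H_Lip: "\<bar>Hilbert C x y - Hilbert C x' y\<bar> \<le> 2 * Thompson C x x'"
    if "x \<in> interior C" "x' \<in> interior C" "y \<in> interior C" for x x' y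
    using F_Lip[OF that] R_Lip[OF that] unfolding Hilbert_def by linarith
  note F = limitin_horo_space[where \<rho> = "Funk C", OF G(1) b v1(1) F_Lip ext(1) F_lim]
  note R = limitin_horo_space[where \<rho> = "RFunk C", OF G(1) b v1(1) R_Lip ext(2) R_lim]
  note H = limitin_horo_space[where \<rho> = "Hilbert C", OF G(1) b v1(1) H_Lip ext(3) H_lim]
  have hF_small: "hF (w + \<delta> *\<^sub>R b) \<le> ln \<delta>" if "\<delta> > 0" for \<delta>
    using Funk_horofunction_near_boundary_point[OF b w_frontier G(1) v1(1) w_G F_lim that]
      add_interior[OF wC b that] by blast
  have hR_bound: "hR (w + \<delta> *\<^sub>R b) \<le> - ln (M w b)" if "\<delta> > 0" for \<delta>
  proof -
    have x: "w + \<delta> *\<^sub>R b \<in> interior C"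
      using add_interior[OF wC b that] .
    have "w \<preceq> 1 *\<^sub>R (w + \<delta> *\<^sub>R b)"
      using pointed_cone_scale[OF pointed interior_in_cone[OF b], of \<delta>] that
      by (simp add: cone_le_def)
    then have "ln (M w (w + \<delta> *\<^sub>R b)) \<le> 0"
      using M_le[OF x] M_pos[OF wC w0 x] by simp
    then show ?thesis
      using x by (simp add: hR_def horo_embed_def RFunk_def)
  qed
  have "hH (w + \<delta> *\<^sub>R b) \<le> ln \<delta> + (- ln (M w b))" if "\<delta> > 0" for \<delta>
    using hF_small[OF that] hR_bound[OF that] add_interior[OF wC b that] by (simp add: hH_def)
  then have boundary: "hF \<in> horo_boundary C b (Funk C)" "hR \<in> horo_boundary C b (RFunk C)"
    "hH \<in> horo_boundary C b (Hilbert C)"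
    using F(2) R(2) H(2) not_Funk_embed[OF b wC w0 hF_small] not_Hilbert_embed[OF b wC]
      RFunk_boundary_not_embed[OF b w_frontier w0]
    unfolding horo_boundary_def hR_def by blast+
  have F_ineq: "hF (f x) \<le> hF x + ln ?r" if x: "x \<in> interior C" for x
  proof (rule tendsto_le[OF G(1) tendsto_add[OF F_lim[OF x] tendsto_ln[OF l_G]] F_lim[OF f_interior[OF x]]])
    have "Funk C (f x) (v n) \<le> Funk C x (v n) + ln (l n)" for n
    proof -
      have "ln (M (f x) (v n)) \<le> ln (l n * M x (v n))"
        using M_f_left_le[OF x] M_pos_interior[OF f_interior[OF x] v1(1)] by (intro ln_mono)
      also have "\<dots> = ln (l n) + ln (M x (v n))"
        using l_pos M_pos_interior[OF x v1(1)] by (intro ln_mult_pos)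
      finally show ?thesis
        by (simp add: Funk_def)
    qed
    then show "\<forall>\<^sub>F n in G. Funk C (f x) (v n) - Funk C b (v n)
        \<le> Funk C x (v n) - Funk C b (v n) + ln (l n)"
      by (intro always_eventually) (auto simp: algebra_simps)
  qed (use radius_pos in simp)
  have R_ineq: "hR (f x) \<le> hR x - ln ?r" if x: "x \<in> interior C" for x
  proof -
    have fx: "f x \<in> interior C"
      using f_interior[OF x] .
    have "ln ?r + ln (M w (f x)) = ln (?r * M w (f x))"
      using radius_pos M_pos[OF wC w0 fx] by (intro ln_mult_pos[symmetric])
    also have "\<dots> \<le> ln (M w x)"
      using M_limit_f_le[OF w x] radius_pos M_pos[OF wC w0 fx] by (intro ln_mono) auto
    finally show ?thesis
      using x fx by (simp add: hR_def horo_embed_def RFunk_def)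
  qed
  have H_ineq: "hH (f x) \<le> hH x" if "x \<in> interior C" for x
    using F_ineq[OF that] R_ineq[OF that] that f_interior[OF that] by (simp add: hH_def)
  have "filtermap v G \<noteq> bot" "eventually (\<lambda>x. x \<in> interior C) (filtermap v G)"
    using G(1) v1(1) by (auto simp: filtermap_bot_iff eventually_filtermap)
  then obtain I :: "('a set \<times> 'a) set" and le where net: "directed_preorder I le"
    "\<And>\<alpha>. \<alpha> \<in> I \<Longrightarrow> snd \<alpha> \<in> interior C" "filtermap snd (net_filter I le) = filtermap v G"
    by (rule net_for_filter) blast
  have net_limitin: "limitin X (\<lambda>\<alpha>. g (snd \<alpha>)) k (net_filter I le)"
    if "limitin X (\<lambda>n. g (v n)) k G" for X :: "('a \<Rightarrow> real) topology" and g k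
    using that limitin_filtermap[of X g k snd "net_filter I le"] limitin_filtermap[of X g k v G] net(3)
    by simp
  have w_net: "(snd \<longlongrightarrow> w) (net_filter I le)"
    using w_G net(3) by (simp add: filterlim_def)
  have net_interior: "\<forall>\<alpha>\<in>I. snd \<alpha> \<in> interior C"
    using net(2) by blast
  have hH_sum: "\<forall>x\<in>interior C. hH x = hF x + hR x"
    by (simp add: hH_def)
  have ineq: "\<forall>x\<in>interior C. hF (f x) \<le> hF x + ln ?r"
    "\<forall>x\<in>interior C. hR (f x) \<le> hR x - ln ?r" "\<forall>x\<in>interior C. hH (f x) \<le> hH x"
    using F_ineq R_ineq H_ineq by blast+
  have hR_RFunk: "\<exists>y\<in>frontier C - {0}. \<forall>x\<in>interior C. hR x = RFunk C x y"
    unfolding hR_def by (rule RFunk_eq_embed[OF b w_frontier w0])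
  show ?thesis
    by (rule exI[of _ I], rule exI[of _ le], rule exI[of _ snd], rule exI[of _ w],
        rule exI[of _ hF], rule exI[of _ hR], rule exI[of _ hH])
      (intro conjI net(1) net_interior w_net w_frontier Nw net_limitin F(1) R(1) H(1) boundary
        hH_sum ineq hR_RFunk)
qed

end
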